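(* Let $X$ be an $n$-dimensional (real) Banach space. For every $\varepsilon\in(0,1)$ there exist $x_1,\dots,x_k\in X$ with $k\geqslant[(1-\varepsilon)^2n]$ such that for all scalars $(a_j)_{j\leqslant k}$ $$\varepsilon\left(\sum_{j\leqslant k}a_j^2\right)^{\frac12}\leqslant\left\|\sum_{j\leqslant k}a_jx_j\right\|_X\leqslant\sum_{j\leqslant k}|a_j|.$$ Equivalently, the identity operator $i_{1,2}:\ell_1^k\to\ell_2^k$ can be written as $i_{1,2}=\alpha\circ\beta$, where $\beta:\ell_1^k\to X$ and $\alpha:X\to\ell_2^k$ are linear operators with $\|\alpha\|\cdot\|\beta\|\leqslant\varepsilon^{-1}$.
   Context: $[x]$ denotes the integer part of $x$. $\ell_p^k$ is $\mathbb{R}^k$ with the $\ell_p$ norm. *)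

theory Defs
  imports "HOL-Analysis.Analysis"
begin

text \<open>
  The dimension \<open>k\<close> is quantified inside the theorem, so \<open>\<real>\<^sup>k\<close> cannot be a type such as
  \<open>real ^ 'k\<close>.  It is the set of sequences vanishing outside \<open>{..<k}\<close>, with pointwise operations;
  because of the vanishing condition, equality in \<open>\<real>\<^sup>k\<close> is equality of functions.
\<close>

definition Rvec :: "nat \<Rightarrow> (nat \<Rightarrow> real) set" where
  "Rvec k = {a. \<forall>j\<ge>k. a j = 0}"

definition lp_norm :: "real \<Rightarrow> nat \<Rightarrow> (nat \<Rightarrow> real) \<Rightarrow> real" where
  "lp_norm p k a = (\<Sum>j<k. \<bar>a j\<bar> powr p) powr (1 / p)"

definition linear_from_Rvec :: "nat \<Rightarrow> ((nat \<Rightarrow> real) \<Rightarrow> 'a::real_vector) \<Rightarrow> bool" where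
  "linear_from_Rvec k T \<longleftrightarrow>
     (\<forall>a\<in>Rvec k. \<forall>b\<in>Rvec k. T (\<lambda>j. a j + b j) = T a + T b) \<and>
     (\<forall>c. \<forall>a\<in>Rvec k. T (\<lambda>j. c * a j) = c *\<^sub>R T a)"

definition linear_to_Rvec :: "nat \<Rightarrow> ('a::real_vector \<Rightarrow> (nat \<Rightarrow> real)) \<Rightarrow> bool" where
  "linear_to_Rvec k T \<longleftrightarrow>
     (\<forall>x. T x \<in> Rvec k) \<and>
     (\<forall>x y. T (x + y) = (\<lambda>j. T x j + T y j)) \<and>
     (\<forall>c x. T (c *\<^sub>R x) = (\<lambda>j. c * T x j))"

text \<open>
  Operator norm of \<open>T\<close> from the space \<open>V\<close> normed by \<open>N\<close> into a space normed by \<open>M\<close>.  The real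
  supremum is meaningful only for bounded \<open>T\<close>; linear maps out of finite-dimensional spaces are
  bounded.
\<close>

definition op_norm :: "'v set \<Rightarrow> ('v \<Rightarrow> real) \<Rightarrow> ('w \<Rightarrow> real) \<Rightarrow> ('v \<Rightarrow> 'w) \<Rightarrow> real" where
  "op_norm V N M T = (SUP v\<in>{v \<in> V. N v \<le> 1}. M (T v))"

lemma lp_norm_1: "lp_norm 1 k a = (\<Sum>j<k. \<bar>a j\<bar>)"
  by (simp add: lp_norm_def sum_nonneg)

lemma lp_norm_2: "lp_norm 2 k a = sqrt (\<Sum>j<k. (a j)\<^sup>2)"
  by (simp add: lp_norm_def powr_half_sqrt sum_nonneg)

end

theory Submission
  imports Defs "Jordan_Normal_Form.Determinant"
begin

text \<open>
  Map \<open>X\<close> into Euclidean space by a contraction \<open>T\<close> of maximal determinant (the Loewner ellipsoid).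
  By maximality, for every symmetric \<open>M\<close> there is a contact point \<open>y = T x\<close>, \<open>\<parallel>x\<parallel> = \<bar>y\<bar> = 1\<close>, with
  \<open>\<langle>M y, y\<rangle> \<le> tr M / n\<close>.  This is all that the Batson--Spielman--Srivastava barrier argument needs:
  contact points are added one at a time, and with \<open>A = \<Sum> y\<^sub>j y\<^sub>j\<^sup>T\<close> one keeps the nonzero eigenvalues
  of \<open>A\<close> above a barrier \<open>b\<close> that decreases by \<open>\<delta>\<close> in each step, while \<open>tr (A - b)\<^sup>-\<^sup>1 \<le> - n - 1 / \<delta>\<close>.
  The barrier moves from \<open>\<epsilon>\<close> to \<open>\<epsilon>\<^sup>2\<close> during \<open>(1 - \<epsilon>)\<^sup>2 n\<close> steps, so the chosen points satisfy
  \<open>\<parallel>\<Sum> a\<^sub>j x\<^sub>j\<parallel> \<ge> \<bar>\<Sum> a\<^sub>j y\<^sub>j\<bar> \<ge> \<epsilon> \<bar>a\<bar>\<close>, and the factorization uses the left inverse of \<open>a \<mapsto> \<Sum> a\<^sub>j y\<^sub>j\<close>.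
\<close>

section \<open>Orthonormal bases in coordinates\<close>

text \<open>The dimension is a value, not a type, so vectors are functions on all of
  \<open>nat\<close> of which only the first \<open>n\<close> coordinates count. Hence
  \<open>dot n u u = 0\<close> does not give \<open>u = 0\<close>, and several later equations hold
  only below \<open>n\<close>.\<close>

definition dot :: "nat \<Rightarrow> (nat \<Rightarrow> real) \<Rightarrow> (nat \<Rightarrow> real) \<Rightarrow> real" where
  "dot n u v = (\<Sum>i<n. u i * v i)"

definition onb :: "nat \<Rightarrow> (nat \<Rightarrow> nat \<Rightarrow> real) \<Rightarrow> bool" where
  "onb n e \<longleftrightarrow> (\<forall>i<n. \<forall>j<n. dot n (e i) (e j) = (if i = j then 1 else 0))"

lemma dot_commute: "dot n u v = dot n v u"
  by (simp add: dot_def mult.commute)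

lemma dot_add_right: "dot n w (\<lambda>l. u l + v l) = dot n w u + dot n w v"
  by (simp add: dot_def algebra_simps sum.distrib)

lemma dot_diff_right: "dot n w (\<lambda>l. u l - v l) = dot n w u - dot n w v"
  by (simp add: dot_def algebra_simps sum_subtractf)

lemma dot_scale_right: "dot n w (\<lambda>l. c * u l) = c * dot n w u"
  by (simp add: dot_def algebra_simps sum_distrib_left)

lemma dot_sum_right: "dot n w (\<lambda>l. \<Sum>i\<in>I. c i * u i l) = (\<Sum>i\<in>I. c i * dot n w (u i))"
  unfolding dot_def sum_distrib_left by (subst sum.swap) (simp add: algebra_simps)

lemma dot_sum_left: "dot n (\<lambda>l. \<Sum>i\<in>I. c i * u i l) w = (\<Sum>i\<in>I. c i * dot n (u i) w)"
  unfolding dot_def sum_distrib_left sum_distrib_right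
  by (subst sum.swap) (simp add: mult.assoc)

lemma dot_self_nonneg: "0 \<le> dot n u u"
  by (simp add: dot_def sum_nonneg)

lemma dot_self: "dot n u u = (\<Sum>i<n. (u i)\<^sup>2)"
  by (simp add: dot_def power2_eq_square)

lemma onb_dot: "onb n e \<Longrightarrow> i < n \<Longrightarrow> j < n \<Longrightarrow> dot n (e i) (e j) = (if i = j then 1 else 0)"
  by (simp add: onb_def)

text \<open>A one-sided inverse of a square matrix is two-sided, so orthonormal rows force
  orthonormal columns. This is the completeness of \<open>e\<close> behind the expansion and
  Parseval's identity.\<close>

lemma onb_columns:
  assumes "onb n e" "k < n" "l < n"
  shows "(\<Sum>i<n. e i k * e i l) = (if k = l then 1 else 0)"
proof -
  define A where "A = Matrix.mat n n (\<lambda>(i,j). e i j)"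
  define B where "B = Matrix.mat n n (\<lambda>(i,j). e j i)"
  have [simp]: "A \<in> carrier_mat n n" "B \<in> carrier_mat n n"
    by (auto simp: A_def B_def)
  have "A * B = 1\<^sub>m n"
    using assms by (intro eq_matI) (auto simp: A_def B_def scalar_prod_def onb_def dot_def atLeast0LessThan)
  then have "B * A = 1\<^sub>m n"
    by (rule mat_mult_left_right_inverse[rotated 2]) auto
  then have "(B * A) $$ (k, l) = (1\<^sub>m n) $$ (k, l)" by simp
  with assms show ?thesis
    by (simp add: A_def B_def scalar_prod_def atLeast0LessThan)
qed

lemma onb_expand:
  assumes "onb n e" "k < n"
  shows "(\<Sum>i<n. dot n (e i) u * e i k) = u k"
proof -
  have "(\<Sum>i<n. dot n (e i) u * e i k) = (\<Sum>l<n. u l * (\<Sum>i<n. e i l * e i k))"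
    unfolding dot_def sum_distrib_left sum_distrib_right
    by (subst sum.swap) (simp add: algebra_simps)
  also have "\<dots> = (\<Sum>l<n. u l * (if l = k then 1 else 0))"
    using assms by (intro sum.cong) (auto simp: onb_columns)
  also have "\<dots> = u k" using assms by (simp add: mult_delta_right)
  finally show ?thesis .
qed

lemma parseval:
  assumes "onb n e"
  shows "dot n u v = (\<Sum>i<n. dot n (e i) u * dot n (e i) v)"
proof -
  have "dot n u v = (\<Sum>k<n. u k * v k)" by (simp add: dot_def)
  also have "\<dots> = (\<Sum>k<n. (\<Sum>i<n. dot n (e i) u * e i k) * v k)"
    using assms by (simp add: onb_expand)
  also have "\<dots> = (\<Sum>i<n. dot n (e i) u * dot n (e i) v)"
    unfolding sum_distrib_right
    by (subst sum.swap) (simp add: dot_def[of n _ v] sum_distrib_left algebra_simps)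
  finally show ?thesis .
qed

lemma parseval_self:
  assumes "onb n e"
  shows "dot n u u = (\<Sum>i<n. (dot n (e i) u)\<^sup>2)"
  unfolding power2_eq_square by (rule parseval[OF assms])

lemma onb_dot_combination:
  assumes "onb n e" "i < n"
  shows "dot n (e i) (\<lambda>l. \<Sum>j<n. c j * e j l) = c i"
proof -
  have "dot n (e i) (\<lambda>l. \<Sum>j<n. c j * e j l) = (\<Sum>j<n. c j * (if i = j then 1 else 0))"
    unfolding dot_sum_right using assms by (intro sum.cong) (auto simp: onb_dot)
  also have "\<dots> = c i" using assms by (simp add: mult_delta_right)
  finally show ?thesis .
qed

lemma onb_standard: "onb n (\<lambda>i j. if i = j then 1 else 0)"
  by (auto simp: onb_def dot_def mult_delta_left)

section \<open>Diagonalisation of Gram operators\<close>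

lemma compact_Pi_UNIV:
  fixes S :: "'i \<Rightarrow> 'a::topological_space set"
  assumes "\<And>i. compact (S i)"
  shows "compact (Pi UNIV S)"
proof -
  have "compactin (product_topology (\<lambda>i. euclidean) UNIV) (PiE UNIV S)"
    using assms by (simp add: compactin_PiE)
  then show ?thesis by (simp add: euclidean_product_topology PiE_UNIV_domain)
qed

lemma compact_bounded_functions:
  fixes C :: "'i \<Rightarrow> real"
  shows "compact {f. \<forall>i. \<bar>f i\<bar> \<le> C i}"
proof -
  have "{f. \<forall>i. \<bar>f i\<bar> \<le> C i} = Pi UNIV (\<lambda>i. {- C i..C i})"
    by (auto simp: Pi_def abs_le_iff minus_le_iff)
  then show ?thesis by (simp add: compact_Pi_UNIV)
qed

lemma compact_bounded_matrices:
  fixes C :: "'i \<Rightarrow> 'j \<Rightarrow> real"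
  shows "compact {f. \<forall>i j. \<bar>f i j\<bar> \<le> C i j}"
proof -
  have "{f. \<forall>i j. \<bar>f i j\<bar> \<le> C i j} = Pi UNIV (\<lambda>i. {f. \<forall>j. \<bar>f j\<bar> \<le> C i j})"
    by auto
  then show ?thesis by (simp add: compact_Pi_UNIV compact_bounded_functions)
qed

lemma continuous_on_entry: "continuous_on UNIV (\<lambda>m :: 'i \<Rightarrow> 'j \<Rightarrow> 'a::topological_space. m i j)"
  by (rule continuous_on_product_then_coordinatewise[OF continuous_on_product_coordinates])

section \<open>Symmetric bilinear forms and plane rotations\<close>

definition quad :: "nat \<Rightarrow> (nat \<Rightarrow> nat \<Rightarrow> real) \<Rightarrow> (nat \<Rightarrow> real) \<Rightarrow> (nat \<Rightarrow> real) \<Rightarrow> real" where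
  "quad n M u v = (\<Sum>k<n. \<Sum>l<n. u k * M k l * v l)"

lemma quad_add_left: "quad n M (\<lambda>k. c * u k + s * v k) w = c * quad n M u w + s * quad n M v w"
  by (simp add: quad_def algebra_simps sum.distrib sum_distrib_left)

lemma quad_add_right: "quad n M w (\<lambda>k. c * u k + s * v k) = c * quad n M w u + s * quad n M w v"
  by (simp add: quad_def algebra_simps sum.distrib sum_distrib_left)

lemma quad_sym:
  assumes "\<And>k l. M k l = M l k"
  shows "quad n M u v = quad n M v u"
  unfolding quad_def by (subst sum.swap) (simp add: assms algebra_simps)

definition rotate_pair :: "real \<Rightarrow> nat \<Rightarrow> nat \<Rightarrow> (nat \<Rightarrow> nat \<Rightarrow> real) \<Rightarrow> nat \<Rightarrow> nat \<Rightarrow> real" where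
  "rotate_pair \<theta> p q e = e(p := \<lambda>k. cos \<theta> * e p k + sin \<theta> * e q k,
                          q := \<lambda>k. (- sin \<theta>) * e p k + cos \<theta> * e q k)"

lemma onb_rotate_pair:
  assumes e: "onb n e" and pq: "p < n" "q < n" "p \<noteq> q"
  shows "onb n (rotate_pair \<theta> p q e)"
proof -
  have lin: "dot n (\<lambda>k. a * u k + b * v k) w = a * dot n u w + b * dot n v w"
    "dot n w (\<lambda>k. a * u k + b * v k) = a * dot n w u + b * dot n w v"
    "dot n (\<lambda>k. a * u k - b * v k) w = a * dot n u w - b * dot n v w"
    "dot n w (\<lambda>k. a * u k - b * v k) = a * dot n w u - b * dot n w v" for a b u v w
    by (simp_all add: dot_def algebra_simps sum.distrib sum_subtractf sum_distrib_left)
  define f where "f = rotate_pair \<theta> p q e"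
  have f: "f p = (\<lambda>k. cos \<theta> * e p k + sin \<theta> * e q k)"
    "f q = (\<lambda>k. cos \<theta> * e q k - sin \<theta> * e p k)" "\<And>i. i \<noteq> p \<Longrightarrow> i \<noteq> q \<Longrightarrow> f i = e i"
    using pq by (auto simp: f_def rotate_pair_def)
  have "dot n (f i) (f j) = (if i = j then 1 else 0)" if "i < n" "j < n" for i j
  proof -
    consider "i = p" | "i = q" | "i \<noteq> p" "i \<noteq> q" by blast
    then show ?thesis
    proof cases
      case 1
      then show ?thesis using that pq e
        by (cases "j = p"; cases "j = q") (simp_all add: f lin onb_dot)
    next
      case 2
      then show ?thesis using that pq e
        by (cases "j = p"; cases "j = q") (simp_all add: f lin onb_dot)
    next
      case 3
      then show ?thesis using that pq e
        by (cases "j = p"; cases "j = q") (simp_all add: f lin onb_dot)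
    qed
  qed
  then show ?thesis by (simp add: onb_def f_def)
qed

text \<open>Jacobi's argument: among all orthonormal bases, take one maximising the sum of the squared
  diagonal entries; a plane rotation that annihilates a nonzero off-diagonal entry would increase it.\<close>

lemma symmetric_diagonal:
  assumes sym: "\<And>k l. M k l = M l k"
  obtains e where "onb n e" "\<And>p q. p < n \<Longrightarrow> q < n \<Longrightarrow> p \<noteq> q \<Longrightarrow> quad n M (e p) (e q) = 0"
proof -
  \<comment> \<open>Entries outside the \<open>n\<close> by \<open>n\<close> block are pinned to 0;
    left free, they would destroy compactness in the function space.\<close>
  define K where "K = {e. onb n e \<and> (\<forall>i j. (i < n \<and> j < n) \<or> e i j = 0)}"
  define \<Phi> where "\<Phi> e = (\<Sum>i<n. (quad n M (e i) (e i))\<^sup>2)" for e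
  have Keq: "K = {e. \<forall>i j. \<bar>e i j\<bar> \<le> (if i < n \<and> j < n then 1 else 0)} \<inter> {e. onb n e}"
  proof -
    have "\<bar>e i j\<bar> \<le> 1" if "onb n e" "i < n" "j < n" for e i j
    proof -
      have "(e i j)\<^sup>2 \<le> (\<Sum>k<n. (e i k)\<^sup>2)"
        by (rule member_le_sum) (use that in auto)
      also have "\<dots> = 1" using onb_dot[OF that(1,2,2)] by (simp add: dot_self)
      finally show ?thesis by (simp add: abs_square_le_1)
    qed
    then have mem: "e \<in> K \<longleftrightarrow> (\<forall>i j. \<bar>e i j\<bar> \<le> (if i < n \<and> j < n then 1 else 0)) \<and> onb n e" for e
      unfolding K_def by (auto split: if_splits)
    show ?thesis by (simp add: set_eq_iff mem)
  qed
  have cl: "closed {e::nat\<Rightarrow>nat\<Rightarrow>real. dot n (e i) (e j) = d}" for i j d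
    unfolding dot_def by (intro closed_Collect_eq continuous_intros continuous_on_entry)
  have "compact K" unfolding Keq onb_def
    by (intro compact_Int_closed compact_bounded_matrices closed_Collect_all closed_Collect_imp
        open_Collect_const cl)
  moreover have "(\<lambda>i j. if i = j \<and> i < n then 1 else 0) \<in> K"
    unfolding K_def by (auto simp: onb_def dot_def mult_delta_left)
  moreover have "continuous_on K \<Phi>"
    unfolding \<Phi>_def quad_def
    by (intro continuous_intros continuous_on_subset[OF continuous_on_entry]) auto
  ultimately obtain e where eK: "e \<in> K" and max: "\<And>f. f \<in> K \<Longrightarrow> \<Phi> f \<le> \<Phi> e"
    using continuous_attains_sup[of K \<Phi>] by blast
  have e: "onb n e" using eK by (simp add: K_def)
  have "quad n M (e p) (e q) = 0" if pq: "p < n" "q < n" "p \<noteq> q" for p q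
  proof (rule ccontr)
    define a b d where "a = quad n M (e p) (e p)" and "b = quad n M (e p) (e q)"
      and "d = quad n M (e q) (e q)"
    assume "quad n M (e p) (e q) \<noteq> 0"
    then have b: "b \<noteq> 0" by (simp add: b_def)
    have b': "quad n M (e q) (e p) = b" using quad_sym[OF sym] by (simp add: b_def)
    \<comment> \<open>This is the off-diagonal entry after rotation by \<theta>. It equals
      \<open>b\<close> at 0 and \<open>- b\<close> at \<open>pi/2\<close>, so it vanishes in
      between.\<close>
    define off where "off \<theta> = ((cos \<theta>)\<^sup>2 - (sin \<theta>)\<^sup>2) * b + cos \<theta> * sin \<theta> * (d - a)" for \<theta>
    have "\<exists>\<theta>. off \<theta> = 0"
    proof -
      have c: "continuous_on {0..pi/2} off" unfolding off_def by (intro continuous_intros)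
      have "off 0 = b" "off (pi/2) = - b" by (auto simp: off_def)
      then show ?thesis
        using IVT'[of off 0 0 "pi/2"] IVT2'[of off "pi/2" 0 0] c
        by (cases "b \<ge> 0") auto
    qed
    then obtain \<theta> where off: "off \<theta> = 0" by blast
    define f where "f = rotate_pair \<theta> p q e"
    have f: "f p = (\<lambda>k. cos \<theta> * e p k + sin \<theta> * e q k)"
      "f q = (\<lambda>k. (- sin \<theta>) * e p k + cos \<theta> * e q k)" "\<And>i. i \<noteq> p \<Longrightarrow> i \<noteq> q \<Longrightarrow> f i = e i"
      using pq by (auto simp: f_def rotate_pair_def)
    have "onb n f" unfolding f_def by (rule onb_rotate_pair[OF e pq])
    moreover have "f i j = 0" if "\<not> (i < n \<and> j < n)" for i j
    proof (cases "i = p \<or> i = q")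
      case True
      then have "e p j = 0" "e q j = 0" using that pq eK by (auto simp: K_def)
      then show ?thesis using True f(1,2) by auto
    next
      case False
      then show ?thesis using f(3)[of i] that eK by (auto simp: K_def)
    qed
    ultimately have "f \<in> K" unfolding K_def by blast
    define a' d' where "a' = quad n M (f p) (f p)" and "d' = quad n M (f q) (f q)"
    define c s where "c = cos \<theta>" and "s = sin \<theta>"
    have cs: "c\<^sup>2 + s\<^sup>2 = 1" by (simp add: c_def s_def)
    have a': "a' = c\<^sup>2 * a + 2 * c * s * b + s\<^sup>2 * d"
      unfolding a'_def f quad_add_left quad_add_right b'
      by (simp add: a_def b_def d_def c_def s_def power2_eq_square algebra_simps)
    have d': "d' = s\<^sup>2 * a - 2 * c * s * b + c\<^sup>2 * d"
      unfolding d'_def f quad_add_left quad_add_right b'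
      by (simp add: a_def b_def d_def c_def s_def power2_eq_square algebra_simps)
    have o: "(c\<^sup>2 - s\<^sup>2) * b + c * s * (d - a) = 0" using off by (simp add: off_def c_def s_def)
    \<comment> \<open>A rotation preserves the Frobenius norm of the symmetric 2 by 2 block, so
      annihilating the off-diagonal entry moves its share \<open>2 * b\<^sup>2\<close> onto the
      diagonal.\<close>
    have "a'\<^sup>2 + d'\<^sup>2 + 2 * ((c\<^sup>2 - s\<^sup>2) * b + c * s * (d - a))\<^sup>2 = (c\<^sup>2 + s\<^sup>2)\<^sup>2 * (a\<^sup>2 + d\<^sup>2 + 2 * b\<^sup>2)"
      unfolding a' d' by (simp add: power2_eq_square algebra_simps)
    then have gain: "a'\<^sup>2 + d'\<^sup>2 = a\<^sup>2 + d\<^sup>2 + 2 * b\<^sup>2" using o cs by simp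
    have split: "(\<Sum>i<n. g i) = g p + g q + (\<Sum>i\<in>{..<n} - {p,q}. g i)" for g :: "nat \<Rightarrow> real"
    proof -
      have "{..<n} = insert p (insert q ({..<n} - {p,q}))" using pq by auto
      then have "(\<Sum>i<n. g i) = sum g (insert p (insert q ({..<n} - {p,q})))" by simp
      then show ?thesis using pq by simp
    qed
    have "\<Phi> f = a'\<^sup>2 + d'\<^sup>2 + (\<Sum>i\<in>{..<n} - {p,q}. (quad n M (e i) (e i))\<^sup>2)"
      unfolding \<Phi>_def split a'_def d'_def using f(3) by (intro arg_cong2[where f="(+)"] sum.cong) auto
    moreover have "\<Phi> e = a\<^sup>2 + d\<^sup>2 + (\<Sum>i\<in>{..<n} - {p,q}. (quad n M (e i) (e i))\<^sup>2)"
      unfolding \<Phi>_def split a_def d_def by simp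
    ultimately have "\<Phi> f > \<Phi> e" using gain b by simp
    with max[OF \<open>f \<in> K\<close>] show False by simp
  qed
  with e show ?thesis by (rule that)
qed

text \<open>Spectral decomposition of \<open>A = \<Sum> w\<^sub>j w\<^sub>j\<^sup>T\<close>, stated
  for the bilinear form: expanding both arguments in the Jacobi basis leaves only the diagonal
  terms.\<close>

lemma gram_diagonal:
  fixes k :: nat
  obtains e d where "onb n e"
    "\<And>u v. (\<Sum>j<k. dot n (w j) u * dot n (w j) v) = (\<Sum>i<n. d i * dot n (e i) u * dot n (e i) v)"
proof -
  define M where "M a b = (\<Sum>j<k. w j a * w j b)" for a b
  define A where "A u v = (\<Sum>j<k. dot n (w j) u * dot n (w j) v)" for u v
  obtain e where e: "onb n e" and off: "\<And>p q. p < n \<Longrightarrow> q < n \<Longrightarrow> p \<noteq> q \<Longrightarrow> quad n M (e p) (e q) = 0"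
    by (rule symmetric_diagonal[of M n]) (simp_all add: M_def mult.commute)
  have A: "A u v = quad n M u v" for u v
  proof -
    have "quad n M u v = (\<Sum>a<n. \<Sum>j<k. \<Sum>b<n. w j a * u a * (w j b * v b))"
      unfolding quad_def M_def sum_distrib_left sum_distrib_right
      by (rule sum.cong[OF refl], subst sum.swap) (simp add: mult_ac)
    also have "\<dots> = (\<Sum>j<k. \<Sum>a<n. \<Sum>b<n. w j a * u a * (w j b * v b))" by (rule sum.swap)
    also have "\<dots> = A u v" by (simp add: A_def dot_def sum_product)
    finally show ?thesis by simp
  qed
  \<comment> \<open>The basis expansion reproduces a vector only on coordinates below
    \<open>n\<close>, so it cannot be substituted as an equality of functions.\<close>
  have cong: "A u v = A u' v'" if "\<And>l. l < n \<Longrightarrow> u l = u' l" "\<And>l. l < n \<Longrightarrow> v l = v' l" for u v u' v'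
    unfolding A quad_def using that by (intro sum.cong) auto
  have "A u v = (\<Sum>i<n. A (e i) (e i) * dot n (e i) u * dot n (e i) v)" for u v
  proof -
    have "A u v = A (\<lambda>l. \<Sum>i<n. dot n (e i) u * e i l) (\<lambda>l. \<Sum>i<n. dot n (e i) v * e i l)"
      by (rule cong) (simp_all add: onb_expand[OF e])
    also have "\<dots> = (\<Sum>j<k. \<Sum>p<n. \<Sum>q<n. dot n (e p) u * dot n (w j) (e p) * (dot n (e q) v * dot n (w j) (e q)))"
      unfolding A_def dot_sum_right by (simp add: sum_product)
    also have "\<dots> = (\<Sum>p<n. \<Sum>q<n. \<Sum>j<k. dot n (e p) u * dot n (w j) (e p) * (dot n (e q) v * dot n (w j) (e q)))"
      by (subst sum.swap, rule sum.cong[OF refl], rule sum.swap)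
    also have "\<dots> = (\<Sum>p<n. \<Sum>q<n. dot n (e p) u * dot n (e q) v * A (e p) (e q))"
      unfolding A_def sum_distrib_left by (simp add: mult_ac)
    also have "\<dots> = (\<Sum>p<n. \<Sum>q<n. if p = q then A (e p) (e p) * dot n (e p) u * dot n (e p) v else 0)"
      by (intro sum.cong refl) (auto simp: A off)
    also have "\<dots> = (\<Sum>p<n. A (e p) (e p) * dot n (e p) u * dot n (e p) v)"
      by (intro sum.cong refl) (simp add: sum.delta)
    finally show ?thesis .
  qed
  with e show ?thesis unfolding A_def by (rule that)
qed

section \<open>The barrier argument\<close>

text \<open>The coefficients \<open>z j = dot n (w j) (e i)\<close> have squared length
  \<open>d i\<close>, and the combination of the \<open>w j\<close> with these coefficients has
  squared length \<open>d i * d i\<close>. The Gram bound at \<open>z\<close> thus becomes a bound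
  on \<open>d i\<close>: it passes from \<open>W\<^sup>T W\<close> to the nonzero spectrum of
  \<open>W W\<^sup>T\<close>.\<close>

lemma gram_eigenvalue_cases:
  fixes k :: nat
  assumes e: "onb n e" and i: "i < n"
    and A: "\<And>u v. (\<Sum>j<k. dot n (w j) u * dot n (w j) v) = (\<Sum>i<n. d i * dot n (e i) u * dot n (e i) v)"
    and gram: "\<And>a. (\<exists>j<k. a j \<noteq> 0) \<Longrightarrow>
      b * (\<Sum>j<k. (a j)\<^sup>2) < dot n (\<lambda>l. \<Sum>j<k. a j * w j l) (\<lambda>l. \<Sum>j<k. a j * w j l)"
  shows "d i = 0 \<and> (\<forall>j<k. dot n (w j) (e i) = 0) \<or> d i > b"
proof -
  define z where "z j = dot n (w j) (e i)" for j
  have Ae: "(\<Sum>j<k. z j * dot n (w j) v) = d i * dot n (e i) v" for v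
  proof -
    have "(\<Sum>j<k. z j * dot n (w j) v) = (\<Sum>m<n. d m * dot n (e m) (e i) * dot n (e m) v)"
      using A[of "e i" v] by (simp add: z_def)
    also have "\<dots> = (\<Sum>m<n. if m = i then d i * dot n (e i) v else 0)"
      using e i by (intro sum.cong) (auto simp: onb_dot)
    finally show ?thesis using i by simp
  qed
  have zz: "(\<Sum>j<k. (z j)\<^sup>2) = d i"
    using Ae[of "e i"] e i by (simp add: z_def onb_dot power2_eq_square)
  show ?thesis
  proof (cases "\<exists>j<k. z j \<noteq> 0")
    case False
    with zz show ?thesis by (auto simp: z_def)
  next
    case True
    have "dot n (\<lambda>l. \<Sum>j<k. z j * w j l) (\<lambda>l. \<Sum>j<k. z j * w j l) = (\<Sum>m<k. z m * (\<Sum>j<k. z j * dot n (w j) (w m)))"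
      by (simp add: dot_sum_right dot_sum_left)
    also have "\<dots> = (\<Sum>m<k. d i * (z m)\<^sup>2)"
      unfolding Ae by (simp add: z_def dot_commute[of n "e i"] power2_eq_square mult_ac)
    also have "\<dots> = d i * d i" by (simp add: sum_distrib_left[symmetric] zz)
    finally have "b * d i < d i * d i" using gram[OF True] zz by simp
    moreover have "d i > 0"
    proof -
      obtain j where "j < k" "z j \<noteq> 0" using True by blast
      then show ?thesis unfolding zz[symmetric] by (intro sum_pos2[of _ j]) auto
    qed
    ultimately show ?thesis by simp
  qed
qed

text \<open>The rank of \<open>k\<close> rank-one terms is at most \<open>k\<close>, proved through \<open>\<langle>w\<^sub>j, A\<^sup>+ w\<^sub>j\<rangle> \<le> 1\<close>
  and the trace of \<open>A\<^sup>+ A\<close>.\<close>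

lemma gram_zero_eigenvalues:
  assumes e: "onb n e"
    and A: "\<And>u v. (\<Sum>j<k. dot n (w j) u * dot n (w j) v) = (\<Sum>i<n. d i * dot n (e i) u * dot n (e i) v)"
  shows "n \<le> k + card {i. i < n \<and> d i = 0}"
proof -
  define N where "N = {i. i < n \<and> d i \<noteq> 0}"
  have le1: "(\<Sum>i\<in>N. (dot n (w j) (e i))\<^sup>2 / d i) \<le> 1" if "j < k" for j
  proof -
    \<comment> \<open>Below, \<open>y\<close> is \<open>A\<^sup>+ w\<^sub>j\<close>; division by a
      zero eigenvalue yields 0, as the pseudoinverse requires. Then \<open>t\<close> is both
      \<langle>w_j, y\<rangle> and \<langle>A y, y\<rangle>, and the latter is at least the square
      of the former.\<close>
    define c where "c i = dot n (w j) (e i) / d i" for i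
    define y where "y = (\<lambda>l. \<Sum>i<n. c i * e i l)"
    define t where "t = (\<Sum>i\<in>N. (dot n (w j) (e i))\<^sup>2 / d i)"
    have N: "(\<Sum>i\<in>N. (dot n (w j) (e i))\<^sup>2 / d i) = (\<Sum>i<n. (dot n (w j) (e i))\<^sup>2 / d i)"
      unfolding N_def by (rule sum.mono_neutral_left) auto
    have "dot n (w j) y = t"
      unfolding y_def dot_sum_right t_def N by (simp add: c_def power2_eq_square)
    moreover have "(\<Sum>l<k. (dot n (w l) y)\<^sup>2) = t"
    proof -
      have "(\<Sum>l<k. (dot n (w l) y)\<^sup>2) = (\<Sum>i<n. d i * (dot n (e i) y)\<^sup>2)"
        using A[of y y] by (simp add: power2_eq_square mult.assoc)
      also have "\<dots> = (\<Sum>i<n. d i * (c i)\<^sup>2)"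
        unfolding y_def by (simp add: onb_dot_combination[OF e])
      also have "\<dots> = t" unfolding t_def N c_def by (intro sum.cong) (auto simp: power2_eq_square)
      finally show ?thesis .
    qed
    moreover have "(dot n (w j) y)\<^sup>2 \<le> (\<Sum>l<k. (dot n (w l) y)\<^sup>2)"
      by (rule member_le_sum) (use that in auto)
    moreover have "0 \<le> (\<Sum>l<k. (dot n (w l) y)\<^sup>2)" by (simp add: sum_nonneg)
    ultimately have "t * t \<le> t * 1" "0 \<le> t" by (simp_all add: power2_eq_square)
    then show ?thesis unfolding t_def[symmetric] by (cases "t = 0") (auto simp: mult_le_cancel_left)
  qed
  have diag: "(\<Sum>j<k. (dot n (w j) (e i))\<^sup>2) = d i" if "i < n" for i
  proof -
    have "(\<Sum>j<k. (dot n (w j) (e i))\<^sup>2) = (\<Sum>m<n. if m = i then d i else 0)"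
      using A[of "e i" "e i"] that e
      by (simp add: power2_eq_square onb_dot if_distrib cong: if_cong)
    then show ?thesis using that by simp
  qed
  have "real (card N) = (\<Sum>i\<in>N. (\<Sum>j<k. (dot n (w j) (e i))\<^sup>2) / d i)"
    by (simp add: diag N_def)
  also have "\<dots> = (\<Sum>j<k. \<Sum>i\<in>N. (dot n (w j) (e i))\<^sup>2 / d i)"
    unfolding sum_divide_distrib by (rule sum.swap)
  also have "\<dots> \<le> (\<Sum>j<k. 1)" by (rule sum_mono) (use le1 in auto)
  finally have "card N \<le> k" by simp
  moreover have "card N + card {i. i < n \<and> d i = 0} = n"
  proof -
    have "N \<union> {i. i < n \<and> d i = 0} = {..<n}" "N \<inter> {i. i < n \<and> d i = 0} = {}"
      by (auto simp: N_def)
    then show ?thesis by (metis card_Un_disjoint card_lessThan finite_Un finite_lessThan)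
  qed
  ultimately show ?thesis by linarith
qed

text \<open>\<open>D\<close> is the change of \<open>tr (A - b)\<^sup>-\<^sup>1\<close> when the
  barrier drops by \<delta> and \<open>A\<close> stays fixed. With \<open>P\<close> the sum of
  \<open>r i * \<rho> i\<close> one gets \<open>D = - \<delta> * P\<close>, and the sum of squares
  is at most \<open>P + \<delta>\<^sup>2 * P\<^sup>2 = D * (D - 1 / \<delta>)\<close>, to which the
  bound on the old potential applies.\<close>

lemma barrier_shift:
  fixes d :: "nat \<Rightarrow> real"
  assumes vals: "\<And>i. i < n \<Longrightarrow> d i = 0 \<or> d i > b"
    and \<delta>: "0 < \<delta>" "\<delta> < b" "b \<le> \<delta> * card {i. i < n \<and> d i = 0}"
    and pot: "(\<Sum>i<n. 1 / (d i - b)) \<le> - real n - 1 / \<delta>"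
  defines "D \<equiv> (\<Sum>i<n. 1 / (d i - (b - \<delta>))) - (\<Sum>i<n. 1 / (d i - b))"
  shows "D < 0" "(\<Sum>i<n. (1 / (d i - (b - \<delta>)))\<^sup>2) \<le> D * (real n + (\<Sum>i<n. 1 / (d i - (b - \<delta>))))"
proof -
  define Z where "Z = {i. i < n \<and> d i = 0}"
  define r where "r i = 1 / (d i - (b - \<delta>))" for i
  define \<rho> where "\<rho> i = 1 / (d i - b)" for i
  define P where "P = (\<Sum>i<n. r i * \<rho> i)"
  have b: "0 < b" "0 < b - \<delta>" using \<delta> by auto
  have ne: "d i - b \<noteq> 0" "d i - (b - \<delta>) \<noteq> 0" if "i < n" for i using vals[OF that] b \<delta> by auto
  have diff: "r i - \<rho> i = - \<delta> * (r i * \<rho> i)" if "i < n" for i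
    using ne[OF that] by (simp add: r_def \<rho>_def field_simps)
  have pos: "r i * \<rho> i > 0" if "i < n" for i
  proof (cases "d i = 0")
    case True
    then show ?thesis using b by (simp add: r_def \<rho>_def mult_neg_pos \<delta>)
  next
    case False
    then have "d i > b" using vals[OF that] by simp
    then show ?thesis using \<delta> by (simp add: r_def \<rho>_def)
  qed
  have fZ: "finite Z" "Z \<subseteq> {..<n}" by (auto simp: Z_def)
  have rZ: "r i * \<rho> i = 1 / (b * (b - \<delta>))" "(r i)\<^sup>2 * \<rho> i = - (1 / (b * (b - \<delta>)\<^sup>2))" if "i \<in> Z" for i
    using that b by (auto simp: Z_def r_def \<rho>_def field_simps power2_eq_square)
  define m where "m = real (card Z)"
  have m: "b \<le> \<delta> * m" using \<delta> by (simp add: m_def Z_def)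
  have mpos: "m > 0" using m b \<delta> by (metis less_le_trans zero_less_mult_pos)
  have D: "D = - \<delta> * P"
    unfolding D_def P_def sum_distrib_left r_def[symmetric] \<rho>_def[symmetric] sum_subtractf[symmetric]
    by (intro sum.cong) (auto simp: diff)
  have PZ: "P \<ge> m / (b * (b - \<delta>))"
  proof -
    have "(\<Sum>i\<in>Z. r i * \<rho> i) \<le> P"
      unfolding P_def by (rule sum_mono2) (use fZ pos in \<open>auto intro: less_imp_le\<close>)
    then show ?thesis by (simp add: rZ m_def)
  qed
  have Ppos: "P > 0" using PZ mpos b by (smt (verit) divide_pos_pos mult_pos_pos)
  show "D < 0" using D Ppos \<delta> by (simp add: mult_pos_pos)
  \<comment> \<open>Only zero eigenvalues make \<open>- ((r i)\<^sup>2 * \<rho> i)\<close> positive,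
    since \<open>\<rho> i > 0\<close> above the barrier.\<close>
  have Q: "- (\<Sum>i<n. (r i)\<^sup>2 * \<rho> i) \<le> \<delta> * P\<^sup>2"
  proof -
    have "- (\<Sum>i<n. (r i)\<^sup>2 * \<rho> i) = (\<Sum>i<n. - ((r i)\<^sup>2 * \<rho> i))" by (simp add: sum_negf)
    also have "\<dots> \<le> (\<Sum>i<n. if i \<in> Z then 1 / (b * (b - \<delta>)\<^sup>2) else 0)"
    proof (rule sum_mono)
      fix i assume "i \<in> {..<n}"
      then have "d i > b" if "i \<notin> Z" using vals[of i] that by (auto simp: Z_def)
      then show "- ((r i)\<^sup>2 * \<rho> i) \<le> (if i \<in> Z then 1 / (b * (b - \<delta>)\<^sup>2) else 0)"
        by (auto simp: rZ) (simp add: \<rho>_def)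
    qed
    also have "\<dots> = (\<Sum>i\<in>Z. 1 / (b * (b - \<delta>)\<^sup>2))"
      using fZ by (simp add: sum.If_cases Int_absorb1)
    also have "\<dots> = m / (b * (b - \<delta>)\<^sup>2)" by (simp add: m_def)
    also have "\<dots> \<le> \<delta> * (m / (b * (b - \<delta>)))\<^sup>2"
    proof -
      \<comment> \<open>Here the number \<open>m\<close> of zero eigenvalues must be large enough
        compared with \<open>b / \<delta>\<close>.\<close>
      have "m * b \<le> m * (\<delta> * m)" using m mpos by simp
      then have "m * b / (b\<^sup>2 * (b - \<delta>)\<^sup>2) \<le> m * (\<delta> * m) / (b\<^sup>2 * (b - \<delta>)\<^sup>2)"
        by (intro divide_right_mono) auto
      then show ?thesis using b by (simp add: power_divide power_mult_distrib) (simp add: power2_eq_square mult.assoc mult.left_commute)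
    qed
    also have "\<dots> \<le> \<delta> * P\<^sup>2"
      using PZ \<delta> mpos b by (intro mult_left_mono power_mono) auto
    finally show ?thesis .
  qed
  have "(\<Sum>i<n. (r i)\<^sup>2) = (\<Sum>i<n. r i * \<rho> i - \<delta> * ((r i)\<^sup>2 * \<rho> i))"
  proof (rule sum.cong, simp)
    fix i assume "i \<in> {..<n}"
    then have "r i = \<rho> i - \<delta> * (r i * \<rho> i)" using diff[of i] by simp
    then have "r i * r i = r i * (\<rho> i - \<delta> * (r i * \<rho> i))" by simp
    then show "(r i)\<^sup>2 = r i * \<rho> i - \<delta> * ((r i)\<^sup>2 * \<rho> i)"
      by (simp add: power2_eq_square algebra_simps)
  qed
  also have "\<dots> = P + \<delta> * (- (\<Sum>i<n. (r i)\<^sup>2 * \<rho> i))"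
    by (simp add: P_def sum_subtractf sum_distrib_left)
  also have "\<dots> \<le> P + \<delta> * (\<delta> * P\<^sup>2)"
    using Q \<delta> by (intro add_left_mono mult_left_mono) auto
  also have "\<dots> = D * (- 1 / \<delta> + D)" using \<delta> unfolding D by (simp add: field_simps power2_eq_square)
  also have "\<dots> \<le> D * (real n + (\<Sum>i<n. r i))"
  proof (rule mult_left_mono_neg)
    have "(\<Sum>i<n. r i) = D + (\<Sum>i<n. \<rho> i)" by (simp add: D_def r_def \<rho>_def)
    then show "real n + (\<Sum>i<n. r i) \<le> - 1 / \<delta> + D" using pot by (simp add: \<rho>_def)
  qed (use \<open>D < 0\<close> in simp)
  finally show "(\<Sum>i<n. (1 / (d i - (b - \<delta>)))\<^sup>2) \<le> D * (real n + (\<Sum>i<n. 1 / (d i - (b - \<delta>))))"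
    by (simp add: r_def)
qed

text \<open>The smallest eigenvalue of the Gram matrix \<open>W\<^sup>T W\<close> exceeds
  \<open>b\<close>; for \<open>b \<ge> 0\<close> this includes linear independence. It is vacuous
  for \<open>k = 0\<close>, where the induction starts.\<close>

definition gram_above :: "nat \<Rightarrow> nat \<Rightarrow> (nat \<Rightarrow> nat \<Rightarrow> real) \<Rightarrow> real \<Rightarrow> bool" where
  "gram_above n k w b \<longleftrightarrow> (\<forall>a. (\<exists>j<k. a j \<noteq> 0) \<longrightarrow>
     b * (\<Sum>j<k. (a j)\<^sup>2) < dot n (\<lambda>l. \<Sum>j<k. a j * w j l) (\<lambda>l. \<Sum>j<k. a j * w j l))"

definition diagonalizes :: "nat \<Rightarrow> nat \<Rightarrow> (nat \<Rightarrow> nat \<Rightarrow> real) \<Rightarrow> (nat \<Rightarrow> nat \<Rightarrow> real) \<Rightarrow> (nat \<Rightarrow> real) \<Rightarrow> bool" where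
  "diagonalizes n k w e d \<longleftrightarrow> onb n e \<and>
     (\<forall>u v. (\<Sum>j<k. dot n (w j) u * dot n (w j) v) = (\<Sum>i<n. d i * dot n (e i) u * dot n (e i) v))"

lemma gram_above_weak:
  assumes "gram_above n k w b"
  shows "b * (\<Sum>j<k. (a j)\<^sup>2) \<le> dot n (\<lambda>l. \<Sum>j<k. a j * w j l) (\<lambda>l. \<Sum>j<k. a j * w j l)"
proof (cases "\<exists>j<k. a j \<noteq> 0")
  case True
  then show ?thesis using assms unfolding gram_above_def by (meson less_imp_le)
next
  case False
  then show ?thesis by (simp add: dot_self_nonneg)
qed

lemma diagonalizes_eigenvalues:
  assumes "diagonalizes n k w e d" "gram_above n k w b" "i < n"
  shows "d i = 0 \<or> d i > b"
  using gram_eigenvalue_cases[of n e i w k d b] assms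
  unfolding diagonalizes_def gram_above_def by blast

text \<open>Complete the square with \<open>c = a + t W\<^sup>T u\<close>, where \<open>u = (W W\<^sup>T - b')\<^sup>-\<^sup>1 x\<close> and \<open>t\<close> is the
  coefficient of the new vector \<open>x\<close>.\<close>

lemma gram_above_extend:
  assumes gram: "gram_above n k w b" and b': "0 < b'" "b' \<le> b"
    and x: "dot n x x = 1"
    and u: "\<And>v. (\<Sum>j<k. dot n (w j) u * dot n (w j) v) - b' * dot n u v = dot n x v"
    and s: "dot n x u < - 1"
  shows "gram_above n (Suc k) (w(k := x)) b'"
  unfolding gram_above_def
proof (intro allI impI)
  fix a :: "nat \<Rightarrow> real"
  assume nz: "\<exists>j<Suc k. a j \<noteq> 0"
  define t where "t = a k"
  define z where "z j = dot n (w j) u" for j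
  define c where "c j = a j + t * z j" for j
  define W where "W f = (\<lambda>l. \<Sum>j<k. f j * w j l)" for f
  define V where "V = (\<lambda>l. \<Sum>j<Suc k. a j * (w(k := x)) j l)"
  have V: "V = (\<lambda>l. (W c l - t * W z l) + t * x l)"
  proof
    fix l
    have "V l = (\<Sum>j<k. a j * w j l) + t * x l" by (simp add: V_def t_def)
    also have "(\<Sum>j<k. a j * w j l) = W c l - t * W z l"
      by (simp add: W_def c_def algebra_simps sum.distrib sum_distrib_left)
    finally show "V l = (W c l - t * W z l) + t * x l" .
  qed
  have Wz: "dot n (W z) v = b' * dot n u v + dot n x v" for v
    using u[of v] by (simp add: W_def dot_sum_left z_def)
  have uW: "dot n u (W f) = (\<Sum>j<k. f j * z j)" for f
    by (simp add: W_def dot_sum_right z_def dot_commute[of n u])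
  define cc cz zz where "cc = (\<Sum>j<k. (c j)\<^sup>2)" and "cz = (\<Sum>j<k. c j * z j)" and "zz = (\<Sum>j<k. (z j)\<^sup>2)"
  define s where "s = dot n x u"
  have zz: "dot n u (W z) = zz" by (simp add: uW zz_def power2_eq_square)
  have xz: "dot n x (W z) = b' * s + 1"
    using Wz[of x] by (simp add: dot_commute[of n x "W z"] dot_commute[of n x u] s_def x)
  have zc: "dot n (W z) (W c) = b' * cz + dot n x (W c)" by (simp add: Wz uW cz_def)
  have zWz: "dot n (W z) (W z) = b' * zz + (b' * s + 1)" by (simp add: Wz zz xz)
  have "dot n V V = dot n (W c) (W c) - 2 * t * dot n (W z) (W c) + t\<^sup>2 * dot n (W z) (W z)
      + 2 * t * (dot n x (W c) - t * dot n x (W z)) + t\<^sup>2 * dot n x x"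
    unfolding V by (simp add: dot_def algebra_simps sum.distrib sum_subtractf sum_distrib_left power2_eq_square)
  then have VV: "dot n V V = dot n (W c) (W c) - 2 * t * b' * cz + t\<^sup>2 * (b' * zz - b' * s)"
    unfolding zc zWz xz x by (simp add: algebra_simps power2_eq_square)
  have aa: "(\<Sum>j<Suc k. (a j)\<^sup>2) = cc - 2 * t * cz + t\<^sup>2 * zz + t\<^sup>2"
  proof -
    have "(\<Sum>j<k. (a j)\<^sup>2) = cc - 2 * t * cz + t\<^sup>2 * zz"
      unfolding cc_def cz_def zz_def sum_distrib_left sum_subtractf[symmetric] sum.distrib[symmetric]
      by (rule sum.cong) (simp_all add: c_def power2_eq_square algebra_simps)
    then show ?thesis by (simp add: t_def)
  qed
  \<comment> \<open>All cross terms between \<open>c\<close> and \<open>t\<close> cancel. What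
    remains is the Gram gap of \<open>c\<close> and a term that is positive for
    \<open>t \<noteq> 0\<close> because \<open>s < - 1\<close>.\<close>
  have eq: "dot n V V - b' * (\<Sum>j<Suc k. (a j)\<^sup>2) = (dot n (W c) (W c) - b' * cc) + t\<^sup>2 * (b' * (- 1 - s))"
    unfolding VV aa by (simp add: algebra_simps)
  have ccnn: "0 \<le> cc" by (simp add: cc_def sum_nonneg)
  have nn: "b' * cc \<le> b * cc" using b' ccnn by (intro mult_right_mono) auto
  have "0 < dot n V V - b' * (\<Sum>j<Suc k. (a j)\<^sup>2)"
  \<comment> \<open>Strictness comes from the added term if \<open>t \<noteq> 0\<close>, and
    otherwise from the old strict bound, since then \<open>c = a\<close> is nonzero below
    \<open>k\<close>.\<close>
  proof (cases "t = 0")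
    case False
    have "b * cc \<le> dot n (W c) (W c)"
      using gram_above_weak[OF gram, of c] by (simp add: W_def cc_def)
    moreover have "0 < t\<^sup>2 * (b' * (- 1 - s))"
      using False b' assms(6) by (simp add: s_def)
    ultimately show ?thesis unfolding eq using nn by linarith
  next
    case True
    then have "c = a" by (simp add: c_def fun_eq_iff)
    moreover have "\<exists>j<k. a j \<noteq> 0" using nz True unfolding t_def by (metis less_Suc_eq)
    ultimately have "\<exists>j<k. c j \<noteq> 0" by simp
    then have "b * cc < dot n (W c) (W c)"
      unfolding W_def cc_def by (rule gram[unfolded gram_above_def, rule_format])
    moreover have "t\<^sup>2 * (b' * (- 1 - s)) = 0" using True by simp
    ultimately show ?thesis unfolding eq using nn by linarith
  qed
  then show "b' * (\<Sum>j<Suc k. (a j)\<^sup>2) < dot n (\<lambda>l. \<Sum>j<Suc k. a j * (w(k := x)) j l) (\<lambda>l. \<Sum>j<Suc k. a j * (w(k := x)) j l)"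
    by (simp add: V_def)
qed

text \<open>Dividing the eigencoordinates by \<open>d i - b\<close> inverts \<open>A - b\<close>.
  The equation is tested against an arbitrary \<open>q\<close> because \<open>A\<close> is available
  only as a bilinear form.\<close>

lemma resolvent_equation:
  assumes diag: "diagonalizes n k w e d" and ne: "\<And>i. i < n \<Longrightarrow> d i \<noteq> b"
  defines "R \<equiv> \<lambda>v l. \<Sum>i<n. (dot n (e i) v / (d i - b)) * e i l"
  shows "(\<Sum>j<k. dot n (w j) (R v) * dot n (w j) q) - b * dot n (R v) q = dot n v q"
proof -
  have e: "onb n e" using diag by (simp add: diagonalizes_def)
  have A: "(\<Sum>j<k. dot n (w j) u * dot n (w j) q) = (\<Sum>i<n. d i * dot n (e i) u * dot n (e i) q)" for u
    using diag by (simp add: diagonalizes_def)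
  have eR: "dot n (e i) (R v) = dot n (e i) v / (d i - b)" if "i < n" for i
    unfolding R_def by (rule onb_dot_combination[OF e that])
  have "(\<Sum>j<k. dot n (w j) (R v) * dot n (w j) q) - b * dot n (R v) q =
      (\<Sum>i<n. d i * dot n (e i) (R v) * dot n (e i) q) - b * (\<Sum>i<n. dot n (e i) (R v) * dot n (e i) q)"
    by (simp only: A parseval[OF e, of "R v" q])
  also have "\<dots> = (\<Sum>i<n. (d i - b) * dot n (e i) (R v) * dot n (e i) q)"
    by (simp add: sum_distrib_left sum_subtractf algebra_simps)
  also have "\<dots> = (\<Sum>i<n. dot n (e i) v * dot n (e i) q)"
    by (intro sum.cong) (auto simp: eR ne)
  also have "\<dots> = dot n v q" by (rule parseval[OF e, symmetric])
  finally show ?thesis .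
qed

text \<open>Sherman--Morrison, evaluated on the eigenbasis of the updated operator and summed up.\<close>

lemma potential_extend:
  assumes diag: "diagonalizes n k w e d" and ne: "\<And>i. i < n \<Longrightarrow> d i \<noteq> b"
    and diag': "diagonalizes n (Suc k) (w(k := x)) e' d'" and ne': "\<And>i. i < n \<Longrightarrow> d' i \<noteq> b"
    and s: "s = (\<Sum>i<n. 1 / (d i - b) * (dot n (e i) x)\<^sup>2)" "1 + s \<noteq> 0"
  shows "(\<Sum>i<n. 1 / (d' i - b)) =
    (\<Sum>i<n. 1 / (d i - b)) - (\<Sum>i<n. (1 / (d i - b))\<^sup>2 * (dot n (e i) x)\<^sup>2) / (1 + s)"
proof -
  have e: "onb n e" and e': "onb n e'" using diag diag' by (auto simp: diagonalizes_def)
  define R where "R v = (\<lambda>l. \<Sum>i<n. (dot n (e i) v / (d i - b)) * e i l)" for v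
  have RR: "(\<Sum>j<k. dot n (w j) (R v) * dot n (w j) q) - b * dot n (R v) q = dot n v q" for v q
    unfolding R_def by (rule resolvent_equation[OF diag ne])
  have Rdot: "dot n v (R q) = (\<Sum>i<n. 1 / (d i - b) * (dot n (e i) v * dot n (e i) q))" for v q
    unfolding R_def dot_sum_right by (simp add: dot_commute[of n v "e i" for i] mult_ac)
  define u where "u = R x"
  have Rsym: "dot n v (R q) = dot n q (R v)" for v q
    by (simp add: Rdot mult_ac)
  have s': "dot n x u = s" by (simp add: u_def Rdot s power2_eq_square)
  have inv: "1 / (d' i - b) = dot n (e' i) (R (e' i)) - (dot n (e' i) u)\<^sup>2 / (1 + s)" if i: "i < n" for i
  proof -
    define v where "v = e' i"
    \<comment> \<open>The Sherman--Morrison coefficient: it makes \<open>dot n x y = c\<close>, so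
      that the contribution of the new vector \<open>x\<close> cancels \<open>c\<close> times the
      resolvent equation of \<open>u\<close>, and \<open>y\<close> is the updated resolvent applied
      to \<open>v\<close>.\<close>
    define c where "c = dot n v u / (1 + s)"
    define y where "y = (\<lambda>l. R v l - c * u l)"
    have ydot: "dot n q y = dot n q (R v) - c * dot n q u" for q
      by (simp add: y_def dot_diff_right dot_scale_right)
    have xy: "dot n x y = c"
      using s(2) by (simp add: ydot s' Rsym[of x v] u_def[symmetric] c_def field_simps)
    have "(\<Sum>j<Suc k. dot n ((w(k := x)) j) y * dot n ((w(k := x)) j) v) - b * dot n y v
        = (\<Sum>j<k. dot n (w j) y * dot n (w j) v) + dot n x y * dot n x v - b * dot n v y"
      by (simp add: dot_commute[of n y v])
    also have "\<dots> = ((\<Sum>j<k. dot n (w j) (R v) * dot n (w j) v) - b * dot n (R v) v)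
        - c * ((\<Sum>j<k. dot n (w j) u * dot n (w j) v) - b * dot n u v) + dot n x y * dot n x v"
      by (simp add: ydot algebra_simps sum_subtractf sum_distrib_left dot_commute[of n v "R v"] dot_commute[of n v u])
    also have "\<dots> = dot n v v" unfolding u_def RR xy by simp
    finally have F: "(\<Sum>j<Suc k. dot n ((w(k := x)) j) y * dot n ((w(k := x)) j) v) - b * dot n y v = dot n v v" .
    have "(\<Sum>j<Suc k. dot n ((w(k := x)) j) y * dot n ((w(k := x)) j) v)
        = (\<Sum>m<n. d' m * dot n (e' m) y * dot n (e' m) v)"
      using diag' unfolding diagonalizes_def by blast
    also have "\<dots> = (\<Sum>m<n. if m = i then d' i * dot n v y else 0)"
      unfolding v_def using i e' by (intro sum.cong) (auto simp: onb_dot)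
    also have "\<dots> = d' i * dot n v y" using i by simp
    finally have "(d' i - b) * dot n v y = 1"
      using F e' i by (simp add: v_def onb_dot dot_commute[of n y "e' i"] algebra_simps)
    then have "1 / (d' i - b) = dot n v y" using ne'[OF i] by (simp add: field_simps)
    then show ?thesis by (simp add: ydot v_def c_def power2_eq_square)
  qed
  \<comment> \<open>The trace of the old resolvent is the same in the new basis \<open>e'\<close> as
    in \<open>e\<close>.\<close>
  have "(\<Sum>i<n. dot n (e' i) (R (e' i))) = (\<Sum>i<n. \<Sum>m<n. 1 / (d m - b) * (dot n (e' i) (e m))\<^sup>2)"
    by (simp add: Rdot power2_eq_square dot_commute)
  also have "\<dots> = (\<Sum>m<n. 1 / (d m - b) * (\<Sum>i<n. (dot n (e' i) (e m))\<^sup>2))"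
    by (subst sum.swap) (simp add: sum_distrib_left)
  also have "\<dots> = (\<Sum>m<n. 1 / (d m - b))"
    unfolding parseval_self[OF e', symmetric] using e by (simp add: onb_dot)
  finally have T: "(\<Sum>i<n. dot n (e' i) (R (e' i))) = (\<Sum>m<n. 1 / (d m - b))" .
  have "(\<Sum>i<n. (dot n (e' i) u)\<^sup>2) = dot n u u"
    by (rule parseval_self[OF e', symmetric])
  also have "\<dots> = (\<Sum>i<n. (dot n (e i) u)\<^sup>2)" by (rule parseval_self[OF e])
  also have "\<dots> = (\<Sum>i<n. (1 / (d i - b))\<^sup>2 * (dot n (e i) x)\<^sup>2)"
  proof (rule sum.cong)
    fix i assume "i \<in> {..<n}"
    then have "dot n (e i) u = dot n (e i) x / (d i - b)"
      unfolding u_def R_def by (intro onb_dot_combination[OF e]) simp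
    then show "(dot n (e i) u)\<^sup>2 = (1 / (d i - b))\<^sup>2 * (dot n (e i) x)\<^sup>2"
      by (simp add: power_divide)
  qed simp
  finally have U: "(\<Sum>i<n. (dot n (e' i) u)\<^sup>2) = (\<Sum>i<n. (1 / (d i - b))\<^sup>2 * (dot n (e i) x)\<^sup>2)" .
  have "(\<Sum>i<n. 1 / (d' i - b)) = (\<Sum>i<n. dot n (e' i) (R (e' i)) - (dot n (e' i) u)\<^sup>2 / (1 + s))"
    using inv by (intro sum.cong) auto
  also have "\<dots> = (\<Sum>i<n. dot n (e' i) (R (e' i))) - (\<Sum>i<n. (dot n (e' i) u)\<^sup>2) / (1 + s)"
    by (simp add: sum_subtractf sum_divide_distrib)
  finally show ?thesis unfolding T U .
qed

text \<open>The sum is \<open>tr (A - b)\<^sup>-\<^sup>1\<close>, expressed through the eigenvalues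
  in some diagonalization.\<close>

definition low_potential :: "nat \<Rightarrow> nat \<Rightarrow> (nat \<Rightarrow> nat \<Rightarrow> real) \<Rightarrow> real \<Rightarrow> real \<Rightarrow> bool" where
  "low_potential n k w \<delta> b \<longleftrightarrow>
     (\<exists>e d. diagonalizes n k w e d \<and> (\<Sum>i<n. 1 / (d i - b)) \<le> - real n - 1 / \<delta>)"

text \<open>The \<open>k\<close> vectors chosen so far leave at least \<open>n - k\<close> zero
  eigenvalues, and \<open>b \<le> \<delta> * (real n - real k)\<close> makes this enough for
  \<open>barrier_shift\<close>. The new point comes from \<open>balanced\<close>, applied in the
  eigenbasis of the current operator.\<close>

lemma barrier_step:
  assumes unit: "\<And>x. x \<in> C \<Longrightarrow> dot n x x = 1"
    and balanced: "\<And>e m. onb n e \<Longrightarrow> \<exists>x\<in>C. (\<Sum>i<n. m i * (dot n (e i) x)\<^sup>2) \<le> (\<Sum>i<n. m i) / real n"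
    and n: "n > 0"
    and \<delta>: "0 < \<delta>" "\<delta> < b" "b \<le> \<delta> * (real n - real k)"
    and gram: "gram_above n k w b" and pot: "low_potential n k w \<delta> b"
  shows "\<exists>x\<in>C. gram_above n (Suc k) (w(k := x)) (b - \<delta>) \<and> low_potential n (Suc k) (w(k := x)) \<delta> (b - \<delta>)"
proof -
  obtain e d where diag: "diagonalizes n k w e d"
    and \<Phi>: "(\<Sum>i<n. 1 / (d i - b)) \<le> - real n - 1 / \<delta>"
    using pot by (auto simp: low_potential_def)
  have e: "onb n e" using diag by (simp add: diagonalizes_def)
  have vals: "d i = 0 \<or> d i > b" if "i < n" for i
    by (rule diagonalizes_eigenvalues[OF diag gram that])
  define b' where "b' = b - \<delta>"
  have b': "0 < b'" "b' < b" using \<delta> by (auto simp: b'_def)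
  define r where "r i = 1 / (d i - b')" for i
  define D where "D = (\<Sum>i<n. r i) - (\<Sum>i<n. 1 / (d i - b))"
  have "n \<le> k + card {i. i < n \<and> d i = 0}"
    by (rule gram_zero_eigenvalues[OF e, where w=w]) (use diag in \<open>simp add: diagonalizes_def\<close>)
  then have "\<delta> * (real n - real k) \<le> \<delta> * card {i. i < n \<and> d i = 0}"
    using \<delta> by (intro mult_left_mono) auto
  then have Z: "b \<le> \<delta> * card {i. i < n \<and> d i = 0}" using \<delta> by linarith
  have D: "D < 0" "(\<Sum>i<n. (r i)\<^sup>2) \<le> D * (real n + (\<Sum>i<n. r i))"
    using barrier_shift[OF vals \<delta>(1,2) Z \<Phi>] by (simp_all add: D_def r_def b'_def)
  \<comment> \<open>With \<open>R = (A - b')\<^sup>-\<^sup>1\<close>, the potential does not increase if \<open>\<langle>R\<^sup>2 x, x\<rangle> \<le> D (1 + \<langle>R x, x\<rangle>)\<close>; this is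
    linear in \<open>x x\<^sup>T\<close>, and \<open>barrier_shift\<close> says that it holds on average.\<close>
  obtain x where x: "x \<in> C"
    and le: "(\<Sum>i<n. ((r i)\<^sup>2 - D * r i) * (dot n (e i) x)\<^sup>2) \<le> (\<Sum>i<n. (r i)\<^sup>2 - D * r i) / real n"
    using balanced[OF e, of "\<lambda>i. (r i)\<^sup>2 - D * r i"] by blast
  define s where "s = (\<Sum>i<n. r i * (dot n (e i) x)\<^sup>2)"
  define uu where "uu = (\<Sum>i<n. (r i)\<^sup>2 * (dot n (e i) x)\<^sup>2)"
  have ne: "d i \<noteq> b'" if "i < n" for i using vals[OF that] b' by auto
  have xx: "(\<Sum>i<n. (dot n (e i) x)\<^sup>2) = 1" using unit[OF x] parseval_self[OF e, of x] by simp
  have "uu - D * s \<le> D"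
  proof -
    have "uu - D * s = (\<Sum>i<n. ((r i)\<^sup>2 - D * r i) * (dot n (e i) x)\<^sup>2)"
      by (simp add: uu_def s_def algebra_simps sum_subtractf sum_distrib_left)
    also have "\<dots> \<le> (\<Sum>i<n. (r i)\<^sup>2 - D * r i) / real n" by (rule le)
    also have "(\<Sum>i<n. (r i)\<^sup>2 - D * r i) = (\<Sum>i<n. (r i)\<^sup>2) - D * (\<Sum>i<n. r i)"
      by (simp add: sum_subtractf sum_distrib_left)
    also have "\<dots> / real n \<le> (D * real n) / real n"
      using D(2) by (intro divide_right_mono) (auto simp: algebra_simps)
    finally show ?thesis using n by simp
  qed
  then have uu: "uu \<le> D * (1 + s)" by (simp add: algebra_simps)
  have "uu > 0"
  proof -
    have "\<exists>i<n. dot n (e i) x \<noteq> 0"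
    proof (rule ccontr)
      assume "\<not> ?thesis"
      then have "(\<Sum>i<n. (dot n (e i) x)\<^sup>2) = 0" by simp
      with xx show False by simp
    qed
    then obtain i where i: "i < n" "dot n (e i) x \<noteq> 0" by blast
    moreover have "r i \<noteq> 0" using ne[OF i(1)] by (simp add: r_def)
    ultimately show ?thesis unfolding uu_def by (intro sum_pos2[of _ i]) auto
  qed
  \<comment> \<open>As \<open>D < 0\<close>, a nonnegative \<open>1 + s\<close> would give
    \<open>uu \<le> 0\<close>. The sign obtained is the condition of
    \<open>gram_above_extend\<close>.\<close>
  then have s: "1 + s < 0" using uu D(1) mult_nonpos_nonneg[of D "1 + s"] by linarith
  define u where "u = (\<lambda>l. \<Sum>i<n. (dot n (e i) x / (d i - b')) * e i l)"
  have gram': "gram_above n (Suc k) (w(k := x)) b'"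
  proof (rule gram_above_extend[OF gram])
    show "(\<Sum>j<k. dot n (w j) u * dot n (w j) v) - b' * dot n u v = dot n x v" for v
      unfolding u_def by (rule resolvent_equation[OF diag ne])
    have "dot n x u = s"
      unfolding u_def dot_sum_right s_def r_def
      by (simp add: dot_commute[of n x "e i" for i] power2_eq_square)
    then show "dot n x u < - 1" using s by simp
  qed (use b' unit[OF x] in auto)
  obtain e' d' where diag': "diagonalizes n (Suc k) (w(k := x)) e' d'"
    unfolding diagonalizes_def by (rule gram_diagonal[of n "w(k := x)" "Suc k"]) blast
  have ne': "d' i \<noteq> b'" if "i < n" for i
    using diagonalizes_eigenvalues[OF diag' gram' that] b' by auto
  have "(\<Sum>i<n. 1 / (d' i - b')) = (\<Sum>i<n. r i) - uu / (1 + s)"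
    unfolding r_def uu_def
    by (rule potential_extend[OF diag ne diag' ne']) (use s in \<open>auto simp: s_def r_def\<close>)
  \<comment> \<open>Dividing \<open>uu \<le> D * (1 + s)\<close> by the negative
    \<open>1 + s\<close> reverses it; the right-hand side is the potential before the step.\<close>
  also have "\<dots> \<le> (\<Sum>i<n. r i) - D"
    using uu s by (simp add: le_divide_eq)
  also have "\<dots> \<le> - real n - 1 / \<delta>" using \<Phi> by (simp add: D_def)
  finally have "low_potential n (Suc k) (w(k := x)) \<delta> b'"
    using diag' by (auto simp: low_potential_def)
  with gram' x show ?thesis unfolding b'_def by blast
qed

text \<open>\<open>balanced\<close> stands in for a John decomposition: if a weighted average of
  \<open>x x\<^sup>T\<close> over \<open>C\<close> is \<open>1 / n\<close> times the identity, some
  point lies at or below the average. The points are chosen by induction, with the barrier at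
  \<open>\<epsilon> - real m * \<delta>\<close> after \<open>m\<close> steps.\<close>

theorem restricted_invertibility:
  assumes unit: "\<And>x. x \<in> C \<Longrightarrow> dot n x x = 1"
    and balanced: "\<And>e m. onb n e \<Longrightarrow> \<exists>x\<in>C. (\<Sum>i<n. m i * (dot n (e i) x)\<^sup>2) \<le> (\<Sum>i<n. m i) / real n"
    and \<epsilon>: "0 < \<epsilon>" "\<epsilon> < 1" and k: "real k \<le> (1 - \<epsilon>)\<^sup>2 * real n"
  shows "\<exists>w. (\<forall>j<k. w j \<in> C) \<and> (\<forall>a. \<epsilon>\<^sup>2 * (\<Sum>j<k. (a j)\<^sup>2)
    \<le> dot n (\<lambda>l. \<Sum>j<k. a j * w j l) (\<lambda>l. \<Sum>j<k. a j * w j l))"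
proof (cases "n = 0")
  case True
  then show ?thesis using k by (auto simp: dot_def)
next
  case False
  then have n: "n > 0" by simp
  \<comment> \<open>The barrier starts at \<open>\<epsilon>\<close>, the choice of \<open>b\<close> that maximises the number
    \<open>(b - \<epsilon>\<^sup>2) (1 - b) n / b\<close> of admissible steps; \<open>\<delta>\<close> solves \<open>- n / b = - n - 1 / \<delta>\<close>.\<close>
  define \<delta> where "\<delta> = \<epsilon> / (real n * (1 - \<epsilon>))"
  have \<delta>: "\<delta> > 0" "\<delta> * real n = \<epsilon> / (1 - \<epsilon>)" using \<epsilon> n by (auto simp: \<delta>_def)
  \<comment> \<open>At most \<open>(1 - \<epsilon>)\<^sup>2 * n\<close> steps of size \<delta> cost
    at most \<open>\<epsilon> - \<epsilon>\<^sup>2\<close> in total.\<close>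
  have bound: "\<epsilon>\<^sup>2 \<le> \<epsilon> - real j * \<delta>" if "j \<le> k" for j
  proof -
    have "real j * \<delta> \<le> (1 - \<epsilon>)\<^sup>2 * real n * \<delta>"
      using that k \<delta> by (intro mult_right_mono) auto
    also have "\<dots> = (1 - \<epsilon>)\<^sup>2 * (\<epsilon> / (1 - \<epsilon>))" unfolding \<delta>(2)[symmetric] by (simp only: mult_ac)
    also have "\<dots> = \<epsilon> - \<epsilon>\<^sup>2" using \<epsilon> by (simp add: power2_eq_square field_simps)
    finally show ?thesis by simp
  qed
  have "\<exists>w. (\<forall>j<m. w j \<in> C) \<and> gram_above n m w (\<epsilon> - real m * \<delta>) \<and> low_potential n m w \<delta> (\<epsilon> - real m * \<delta>)"
    if "m \<le> k" for m
    using that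
  proof (induction m)
    case 0
    have "diagonalizes n 0 w (\<lambda>i j. if i = j then 1 else 0) (\<lambda>_. 0)" for w
      by (simp add: diagonalizes_def onb_standard)
    moreover have "(\<Sum>i<n. 1 / (0 - \<epsilon>)) \<le> - real n - 1 / \<delta>"
      using \<epsilon> n by (simp add: \<delta>_def field_simps)
    ultimately have "low_potential n 0 w \<delta> \<epsilon>" for w
      unfolding low_potential_def by blast
    then show ?case by (simp add: gram_above_def)
  next
    case (Suc m)
    then obtain w where w: "\<forall>j<m. w j \<in> C" "gram_above n m w (\<epsilon> - real m * \<delta>)"
      "low_potential n m w \<delta> (\<epsilon> - real m * \<delta>)" by auto
    have "0 < \<epsilon> - real (Suc m) * \<delta>" using bound[OF Suc.prems] \<epsilon> by (smt (verit) zero_less_power)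
    then have 1: "\<delta> < \<epsilon> - real m * \<delta>" by (simp add: algebra_simps)
    \<comment> \<open>Both sides of the condition on zero eigenvalues drop by \<delta> in each step,
      so it only has to be checked at the start.\<close>
    have "\<epsilon> \<le> \<delta> * real n" using \<epsilon> unfolding \<delta>(2) by (simp add: field_simps)
    then have 2: "\<epsilon> - real m * \<delta> \<le> \<delta> * (real n - real m)" by (simp add: algebra_simps)
    obtain x where x: "x \<in> C" "gram_above n (Suc m) (w(m := x)) (\<epsilon> - real m * \<delta> - \<delta>)"
      "low_potential n (Suc m) (w(m := x)) \<delta> (\<epsilon> - real m * \<delta> - \<delta>)"
      using barrier_step[OF unit balanced n \<delta>(1) 1 2 w(2,3)] by blast
    have eq: "\<epsilon> - real m * \<delta> - \<delta> = \<epsilon> - real (Suc m) * \<delta>" by (simp add: algebra_simps)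
    have "\<forall>j<Suc m. (w(m := x)) j \<in> C" using x(1) w(1) by (simp add: less_Suc_eq)
    with x(2,3) show ?case unfolding eq by blast
  qed
  then obtain w where w: "\<forall>j<k. w j \<in> C" "gram_above n k w (\<epsilon> - real k * \<delta>)" by blast
  have "\<epsilon>\<^sup>2 * (\<Sum>j<k. (a j)\<^sup>2) \<le> dot n (\<lambda>l. \<Sum>j<k. a j * w j l) (\<lambda>l. \<Sum>j<k. a j * w j l)" for a
  proof -
    have "\<epsilon>\<^sup>2 * (\<Sum>j<k. (a j)\<^sup>2) \<le> (\<epsilon> - real k * \<delta>) * (\<Sum>j<k. (a j)\<^sup>2)"
      by (intro mult_right_mono bound sum_nonneg) auto
    then show ?thesis using gram_above_weak[OF w(2), of a] by linarith
  qed
  with w(1) show ?thesis by blast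
qed

section \<open>Contact points of the maximal-volume contraction\<close>

text \<open>Matrices remain functions, so that the topology of function spaces applies to them; only
  the determinant passes through \<open>Matrix.mat\<close>.\<close>

definition vol :: "nat \<Rightarrow> (nat \<Rightarrow> nat \<Rightarrow> real) \<Rightarrow> real" where
  "vol n m = Determinant.det (Matrix.mat n n (\<lambda>(i, j). m i j))"

text \<open>By the Leibniz formula, \<open>vol n\<close> is a polynomial in the entries.\<close>

lemma continuous_on_vol: "continuous_on UNIV (vol n)"
proof -
  have "vol n m = (\<Sum>p | p permutes {0..<n}. signof p * (\<Prod>i = 0..<n. m i (p i)))" for m
    unfolding vol_def
    by (subst det_def'[of _ n]) (auto intro!: sum.cong prod.cong simp: permutes_in_image)
  then have "vol n = (\<lambda>m. \<Sum>p | p permutes {0..<n}. signof p * (\<Prod>i = 0..<n. m i (p i)))"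
    by (rule ext)
  then show ?thesis by (simp add: continuous_intros continuous_on_entry)
qed

lemma vol_mult: "vol n (\<lambda>i j. \<Sum>k<n. a i k * b k j) = vol n a * vol n b"
proof -
  have "Matrix.mat n n (\<lambda>(i, j). \<Sum>k<n. a i k * b k j)
      = Matrix.mat n n (\<lambda>(i, j). a i j) * Matrix.mat n n (\<lambda>(i, j). b i j)"
    by (intro eq_matI) (auto simp: scalar_prod_def atLeast0LessThan)
  then show ?thesis unfolding vol_def by (simp add: Determinant.det_mult[of _ n])
qed

lemma vol_diagonal: "vol n (\<lambda>i j. if i = j then s i else 0) = (\<Prod>i<n. s i)"
proof -
  define A where "A = Matrix.mat n n (\<lambda>(i, j). if i = j then s i else 0)"
  have A: "A \<in> carrier_mat n n" by (simp add: A_def)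
  have "upper_triangular A" by (auto simp: A_def)
  then have "Determinant.det A = prod_list (diag_mat A)" using A by (rule det_upper_triangular)
  also have "\<dots> = (\<Prod>i<n. s i)"
    unfolding prod_list_diag_prod using A by (auto simp: A_def atLeast0LessThan intro: prod.cong)
  finally show ?thesis by (simp add: vol_def A_def)
qed

lemma vol_cong:
  assumes "\<And>i j. i < n \<Longrightarrow> j < n \<Longrightarrow> a i j = b i j"
  shows "vol n a = vol n b"
proof -
  have "Matrix.mat n n (\<lambda>(i, j). a i j) = Matrix.mat n n (\<lambda>(i, j). b i j)"
    using assms by (intro eq_matI) auto
  then show ?thesis by (simp add: vol_def)
qed

lemma vol_onb:
  assumes "onb n e"
  shows "\<bar>vol n e\<bar> = 1"
proof -
  have T: "vol n (\<lambda>i j. e j i) = vol n e"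
  proof -
    have "Matrix.mat n n (\<lambda>(i, j). e j i) = transpose_mat (Matrix.mat n n (\<lambda>(i, j). e i j))"
      by (intro eq_matI) auto
    then show ?thesis unfolding vol_def by (simp add: det_transpose[of _ n])
  qed
  have "vol n e * vol n (\<lambda>i j. e j i) = vol n (\<lambda>i j. if i = j then 1 else 0)"
    unfolding vol_mult[symmetric]
    by (rule vol_cong) (use assms in \<open>simp add: onb_def dot_def\<close>)
  also have "\<dots> = 1" by (simp add: vol_diagonal)
  finally have "(vol n e)\<^sup>2 = 1" by (simp add: T power2_eq_square)
  then show ?thesis by (simp add: abs_square_eq_1)
qed

text \<open>At \<open>t = 0\<close> the product is 1 and its derivative is minus the sum of the
  \<open>N i\<close>, hence positive. This is the first-order volume gain that contradicts
  maximality.\<close>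

lemma prod_perturb_gt_1:
  fixes N :: "nat \<Rightarrow> real"
  assumes "(\<Sum>i<n. N i) < 0" "\<eta> > 0"
  shows "\<exists>t. 0 < t \<and> t < \<eta> \<and> (\<Prod>i<n. 1 - t * N i) > 1"
proof -
  have "((\<lambda>t. \<Prod>i<n. 1 - t * N i) has_field_derivative (\<Sum>i<n. - N i * (\<Prod>j\<in>{..<n}-{i}. 1 - 0 * N j))) (at 0)"
    by (rule has_field_derivative_prod) (auto intro!: derivative_eq_intros)
  then have "((\<lambda>t. \<Prod>i<n. 1 - t * N i) has_field_derivative - (\<Sum>i<n. N i)) (at 0)"
    by (simp add: sum_negf)
  from DERIV_pos_inc_right[OF this] assms(1) obtain h where h: "h > 0"
    "\<And>t. t > 0 \<Longrightarrow> t < h \<Longrightarrow> (\<Prod>i<n. 1 - t * N i) > 1" by auto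
  define t where "t = min h \<eta> / 2"
  have "0 < t" "t < h" "t < \<eta>" using h(1) assms(2) by (auto simp: t_def)
  with h(2)[of t] show ?thesis by blast
qed

section \<open>The Euclidean sphere in coordinates, and comparison with the given norm\<close>

lemma compact_coordinate_sphere: "compact {c. dot n c c = 1 \<and> (\<forall>j\<ge>n. c j = 0)}"
proof -
  have "\<bar>c j\<bar> \<le> 1" if "dot n c c = 1" "j < n" for c j
  proof -
    have "(c j)\<^sup>2 \<le> (\<Sum>k<n. (c k)\<^sup>2)" by (rule member_le_sum) (use that in auto)
    then show ?thesis using that by (simp add: dot_self abs_square_le_1)
  qed
  then have "{c. dot n c c = 1 \<and> (\<forall>j\<ge>n. c j = 0)} =
      {c. \<forall>j. \<bar>c j\<bar> \<le> (if j < n then 1 else 0)} \<inter> {c. dot n c c = 1}"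
    by (auto simp: not_less)
  moreover have "closed {c. dot n c c = 1}"
    unfolding dot_def by (intro closed_Collect_eq continuous_intros continuous_on_product_coordinates)
  ultimately show ?thesis by (simp add: compact_Int_closed compact_bounded_functions)
qed

lemma normalize_coordinates:
  fixes b :: "nat \<Rightarrow> 'a::real_normed_vector"
  assumes "dot n c c \<noteq> 0"
  defines "a \<equiv> 1 / sqrt (dot n c c)"
  defines "c' \<equiv> (\<lambda>j. if j < n then a * c j else 0)"
  shows "a > 0" "dot n c' c' = 1" "\<forall>j\<ge>n. c' j = 0" "dot n u c' = a * dot n u c"
    "norm (\<Sum>j<n. c' j *\<^sub>R b j) = a * norm (\<Sum>j<n. c j *\<^sub>R b j)"
proof -
  have pos: "dot n c c > 0" using assms(1) dot_self_nonneg[of n c] by linarith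
  then show a: "a > 0" by (simp add: a_def)
  have aa: "a * a * dot n c c = 1"
    using pos by (simp add: a_def real_sqrt_mult_self)
  have "dot n c' c' = a * a * dot n c c"
    unfolding dot_def c'_def by (simp add: sum_distrib_left mult_ac)
  with aa show "dot n c' c' = 1" by simp
  show "\<forall>j\<ge>n. c' j = 0" by (simp add: c'_def)
  show "dot n u c' = a * dot n u c"
    unfolding dot_def c'_def by (simp add: sum_distrib_left mult_ac)
  have "(\<Sum>j<n. c' j *\<^sub>R b j) = a *\<^sub>R (\<Sum>j<n. c j *\<^sub>R b j)"
    unfolding c'_def by (simp add: scaleR_sum_right)
  then show "norm (\<Sum>j<n. c' j *\<^sub>R b j) = a * norm (\<Sum>j<n. c j *\<^sub>R b j)" using a by simp
qed

lemma continuous_on_norm_combination: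
  fixes b :: "nat \<Rightarrow> 'a::real_normed_vector"
  shows "continuous_on UNIV (\<lambda>c. norm (\<Sum>j<n. c j *\<^sub>R b j))"
  by (intro continuous_intros continuous_on_product_coordinates)

text \<open>The norm attains a minimum on the compact sphere, positive by independence. This
  supplies a first contraction with nonzero determinant, a multiple of the identity.\<close>

lemma norm_combination_lower_bound:
  fixes b :: "nat \<Rightarrow> 'a::real_normed_vector"
  assumes indep: "\<And>c. (\<Sum>j<n. c j *\<^sub>R b j) = 0 \<Longrightarrow> dot n c c = 0"
  shows "\<exists>s>0. \<forall>c. s\<^sup>2 * dot n c c \<le> (norm (\<Sum>j<n. c j *\<^sub>R b j))\<^sup>2"
proof (cases "n = 0")
  case True
  then show ?thesis by (intro exI[of _ 1]) (simp add: dot_def)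
next
  case False
  define S where "S = {c. dot n c c = 1 \<and> (\<forall>j\<ge>n. c j = 0)}"
  have "(\<lambda>j. if j = 0 then 1 else 0) \<in> S"
    using False by (auto simp: S_def dot_def mult_delta_left)
  moreover have "compact S" unfolding S_def by (rule compact_coordinate_sphere)
  moreover have "continuous_on S (\<lambda>c. norm (\<Sum>j<n. c j *\<^sub>R b j))"
    by (rule continuous_on_subset[OF continuous_on_norm_combination]) simp
  ultimately obtain c0 where c0: "c0 \<in> S"
    and min: "\<And>c. c \<in> S \<Longrightarrow> norm (\<Sum>j<n. c0 j *\<^sub>R b j) \<le> norm (\<Sum>j<n. c j *\<^sub>R b j)"
    using continuous_attains_inf[of S "\<lambda>c. norm (\<Sum>j<n. c j *\<^sub>R b j)"] by blast
  define s where "s = norm (\<Sum>j<n. c0 j *\<^sub>R b j)"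
  have "s > 0" using c0 indep[of c0] by (auto simp: s_def S_def)
  moreover have "s\<^sup>2 * dot n c c \<le> (norm (\<Sum>j<n. c j *\<^sub>R b j))\<^sup>2" for c
  proof (cases "dot n c c = 0")
    case False
    note nc = normalize_coordinates[OF False]
    have pos: "dot n c c > 0" using False dot_self_nonneg[of n c] by linarith
    have "s \<le> 1 / sqrt (dot n c c) * norm (\<Sum>j<n. c j *\<^sub>R b j)"
      unfolding s_def nc(5)[symmetric] by (rule min) (use nc(2,3) in \<open>simp add: S_def\<close>)
    then have "s * sqrt (dot n c c) \<le> norm (\<Sum>j<n. c j *\<^sub>R b j)"
      using pos by (simp add: field_simps)
    then have "(s * sqrt (dot n c c))\<^sup>2 \<le> (norm (\<Sum>j<n. c j *\<^sub>R b j))\<^sup>2"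
      using \<open>s > 0\<close> pos by (intro power_mono) auto
    then show ?thesis using pos by (simp add: power_mult_distrib)
  qed simp
  ultimately show ?thesis by blast
qed

text \<open>Testing a contraction on coordinate unit vectors bounds its entries, so the contractions
  supported on the block form a compact set, where the continuous \<open>\<bar>vol n m\<bar>\<close>
  has a maximum. The contraction \<open>m0\<close> shows that it is positive.\<close>

lemma maximal_volume:
  fixes b :: "nat \<Rightarrow> 'a::real_normed_vector"
  assumes indep: "\<And>c. (\<Sum>j<n. c j *\<^sub>R b j) = 0 \<Longrightarrow> dot n c c = 0"
  obtains m where "vol n m \<noteq> 0"
    "\<And>c. (\<Sum>i<n. (dot n (m i) c)\<^sup>2) \<le> (norm (\<Sum>j<n. c j *\<^sub>R b j))\<^sup>2"
    "\<And>g. (\<And>c. (\<Sum>i<n. (dot n (g i) c)\<^sup>2) \<le> (norm (\<Sum>j<n. c j *\<^sub>R b j))\<^sup>2) \<Longrightarrow> \<bar>vol n g\<bar> \<le> \<bar>vol n m\<bar>"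
proof -
  define adm where "adm m \<longleftrightarrow> (\<forall>c. (\<Sum>i<n. (dot n (m i) c)\<^sup>2) \<le> (norm (\<Sum>j<n. c j *\<^sub>R b j))\<^sup>2)" for m
  define B where "B = {m. \<forall>i j. \<bar>m i j\<bar> \<le> (if i < n \<and> j < n then norm (b j) else 0)}"
  have adm_entry: "\<bar>m i j\<bar> \<le> norm (b j)" if "adm m" "i < n" "j < n" for m i j
  proof -
    define c :: "nat \<Rightarrow> real" where "c l = (if l = j then 1 else 0)" for l
    have "(m i j)\<^sup>2 = (dot n (m i) c)\<^sup>2" using that by (simp add: dot_def c_def mult_delta_right)
    also have "\<dots> \<le> (\<Sum>i<n. (dot n (m i) c)\<^sup>2)" by (rule member_le_sum) (use that in auto)
    also have "\<dots> \<le> (norm (\<Sum>j<n. c j *\<^sub>R b j))\<^sup>2" using that by (simp add: adm_def)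
    also have "(\<Sum>j<n. c j *\<^sub>R b j) = (\<Sum>l<n. if l = j then b l else 0)"
      by (intro sum.cong) (auto simp: c_def)
    also have "\<dots> = b j" using that by simp
    finally show ?thesis using abs_le_square_iff[of "m i j" "norm (b j)"] by simp
  qed
  have "closed {m. adm m}"
    unfolding adm_def dot_def
    by (intro closed_Collect_all closed_Collect_le continuous_intros continuous_on_entry)
  then have "compact (B \<inter> {m. adm m})"
    unfolding B_def by (intro compact_Int_closed compact_bounded_matrices)
  moreover obtain s where s: "s > 0" "\<And>c. s\<^sup>2 * dot n c c \<le> (norm (\<Sum>j<n. c j *\<^sub>R b j))\<^sup>2"
    using norm_combination_lower_bound[OF indep] by blast
  define m0 where "m0 i j = (if i = j then if i < n then s else 0 else 0)" for i j :: nat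
  have "adm m0"
  proof -
    have "(\<Sum>i<n. (dot n (m0 i) c)\<^sup>2) = s\<^sup>2 * dot n c c" for c
      by (simp add: dot_self sum_distrib_left) (simp add: dot_def m0_def mult_delta_left power_mult_distrib)
    then show ?thesis using s by (simp add: adm_def)
  qed
  \<comment> \<open>Cutting off entries outside the block changes neither the contraction property
    nor the volume, so the maximum over the compact set is a maximum over all contractions.\<close>
  have restrict: "(\<lambda>i j. if i < n \<and> j < n then g i j else 0) \<in> B \<inter> {m. adm m}" if "adm g" for g
  proof -
    have "dot n (\<lambda>j. if i < n \<and> j < n then g i j else 0) c = dot n (g i) c" if "i < n" for i c
      unfolding dot_def using that by (intro sum.cong) auto
    then have "adm (\<lambda>i j. if i < n \<and> j < n then g i j else 0)"
      using that by (simp add: adm_def)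
    then show ?thesis using adm_entry[OF that] by (simp add: B_def)
  qed
  have "continuous_on (B \<inter> {m. adm m}) (\<lambda>m. \<bar>vol n m\<bar>)"
    by (intro continuous_intros continuous_on_subset[OF continuous_on_vol]) auto
  ultimately obtain m where m: "m \<in> B \<inter> {m. adm m}"
    and max: "\<And>g. g \<in> B \<inter> {m. adm m} \<Longrightarrow> \<bar>vol n g\<bar> \<le> \<bar>vol n m\<bar>"
    using continuous_attains_sup[of "B \<inter> {m. adm m}" "\<lambda>m. \<bar>vol n m\<bar>"] restrict[OF \<open>adm m0\<close>] by blast
  have max': "\<bar>vol n g\<bar> \<le> \<bar>vol n m\<bar>" if "adm g" for g
  proof -
    have "vol n g = vol n (\<lambda>i j. if i < n \<and> j < n then g i j else 0)" by (rule vol_cong) simp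
    then show ?thesis using max[OF restrict[OF that]] by simp
  qed
  have "vol n m0 = s ^ n" unfolding m0_def vol_diagonal by simp
  then have "vol n m \<noteq> 0" using max'[OF \<open>adm m0\<close>] zero_less_power[OF s(1), of n] by auto
  then show ?thesis using that m max' by (simp add: adm_def)
qed

text \<open>John's optimality condition in dual form: if it failed for \<open>\<nu>\<close>, stretching the optimal
  ellipsoid by \<open>1 - t (\<nu>\<^sub>i - mean - 1/(k+1))\<close> along \<open>e\<^sub>i\<close> would, for small \<open>t\<close>, increase the volume while
  keeping the map a contraction; a limit of points where it fails to be a contraction is a contact point.\<close>

lemma maximal_volume_contact_points:
  fixes b :: "nat \<Rightarrow> 'a::real_normed_vector"
  assumes indep: "\<And>c. (\<Sum>j<n. c j *\<^sub>R b j) = 0 \<Longrightarrow> dot n c c = 0"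
    and n: "n > 0" and vol: "vol n m \<noteq> 0"
    and contr: "\<And>c. (\<Sum>i<n. (dot n (m i) c)\<^sup>2) \<le> (norm (\<Sum>j<n. c j *\<^sub>R b j))\<^sup>2"
    and max: "\<And>g. (\<And>c. (\<Sum>i<n. (dot n (g i) c)\<^sup>2) \<le> (norm (\<Sum>j<n. c j *\<^sub>R b j))\<^sup>2) \<Longrightarrow> \<bar>vol n g\<bar> \<le> \<bar>vol n m\<bar>"
    and e: "onb n e"
  shows "\<exists>c. norm (\<Sum>j<n. c j *\<^sub>R b j) = 1 \<and> (\<Sum>i<n. (dot n (m i) c)\<^sup>2) = 1 \<and>
    (\<Sum>i<n. \<nu> i * (dot n (e i) (\<lambda>l. dot n (m l) c))\<^sup>2) \<le> (\<Sum>i<n. \<nu> i) / real n"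
proof (rule ccontr)
  define mean where "mean = (\<Sum>i<n. \<nu> i) / real n"
  define Y where "Y c i = dot n (e i) (\<lambda>l. dot n (m l) c)" for c i
  define p where "p c = norm (\<Sum>j<n. c j *\<^sub>R b j)" for c
  assume "\<not> ?thesis"
  then have contra: "(\<Sum>i<n. \<nu> i * (Y c i)\<^sup>2) > mean"
    if "p c = 1" "(\<Sum>i<n. (dot n (m i) c)\<^sup>2) = 1" for c
    using that unfolding p_def Y_def mean_def by (meson not_less)
  have Y2: "(\<Sum>i<n. (Y c i)\<^sup>2) = (\<Sum>i<n. (dot n (m i) c)\<^sup>2)" for c
    unfolding Y_def parseval_self[OF e, symmetric] dot_self[of n "\<lambda>l. dot n (m l) c"] by (rule refl)
  \<comment> \<open>The numbers \<open>\<nu> i - mean\<close> sum to 0; the extra term makes the sum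
    negative, so the volume grows to first order, and it disappears as \<open>k\<close> tends to
    infinity.\<close>
  define N where "N k i = \<nu> i - mean - 1 / (real k + 1)" for k :: nat and i
  define S where "S = {c. dot n c c = 1 \<and> (\<forall>j\<ge>n. c j = 0)}"
  have step: "\<exists>t c. 0 < t \<and> t < 1 / (real k + 1) \<and> c \<in> S \<and> (p c)\<^sup>2 < (\<Sum>i<n. ((1 - t * N k i) * Y c i)\<^sup>2)" for k
  proof -
    have "(\<Sum>i<n. N k i) = - (real n / (real k + 1))"
      using n by (simp add: N_def sum_subtractf mean_def)
    moreover have "real n / (real k + 1) > 0" using n by simp
    ultimately have "(\<Sum>i<n. N k i) < 0" by linarith
    then obtain t where t: "0 < t" "t < 1 / (real k + 1)" "(\<Prod>i<n. 1 - t * N k i) > 1"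
      using prod_perturb_gt_1[of "N k" n "1 / (real k + 1)"] by auto
    define s where "s i = 1 - t * N k i" for i
    define h where "h i j = (\<Sum>l<n. e i l * m l j)" for i j
    \<comment> \<open>The map \<open>m\<close>, followed by passage to \<open>e\<close>-coordinates
      and by the diagonal stretching \<open>s\<close>.\<close>
    define g where "g i j = (\<Sum>l<n. (if i = l then s i else 0) * h l j)" for i j
    have g: "dot n (g i) c = s i * Y c i" if "i < n" for i c
    proof -
      have "dot n (g i) c = (\<Sum>j<n. s i * h i j * c j)"
        unfolding dot_def g_def using that by (simp add: mult_delta_left)
      also have "\<dots> = s i * (\<Sum>j<n. \<Sum>l<n. e i l * m l j * c j)"
        by (simp add: h_def sum_distrib_left sum_distrib_right mult_ac)
      also have "(\<Sum>j<n. \<Sum>l<n. e i l * m l j * c j) = Y c i"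
        unfolding Y_def dot_def sum_distrib_left by (subst sum.swap) (simp add: mult_ac)
      finally show ?thesis .
    qed
    have "vol n g = (\<Prod>i<n. s i) * (vol n e * vol n m)"
      unfolding g_def[abs_def] vol_mult vol_diagonal h_def[abs_def] by (rule refl)
    then have "\<bar>vol n g\<bar> = \<bar>\<Prod>i<n. s i\<bar> * \<bar>vol n m\<bar>"
      by (simp add: abs_mult vol_onb[OF e])
    moreover have "1 * \<bar>vol n m\<bar> < \<bar>\<Prod>i<n. s i\<bar> * \<bar>vol n m\<bar>"
      using t(3) vol unfolding s_def by (intro mult_strict_right_mono) linarith+
    ultimately have "\<not> \<bar>vol n g\<bar> \<le> \<bar>vol n m\<bar>" by simp
    then obtain c where c: "\<not> (\<Sum>i<n. (dot n (g i) c)\<^sup>2) \<le> (p c)\<^sup>2"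
      using max[of g] unfolding p_def by blast
    have nz: "dot n c c \<noteq> 0"
    proof
      assume "dot n c c = 0"
      then have "c j = 0" if "j < n" for j
        using that by (simp add: dot_self sum_nonneg_eq_0_iff)
      then have "dot n (g i) c = 0" for i by (simp add: dot_def)
      then show False using c by simp
    qed
    define a where "a = 1 / sqrt (dot n c c)"
    define c' where "c' = (\<lambda>j. if j < n then a * c j else 0)"
    note nc = normalize_coordinates[OF nz, folded a_def, folded c'_def]
    have "p c' = a * p c"
      unfolding p_def c'_def a_def by (rule normalize_coordinates(5)[OF nz])
    moreover have "(\<Sum>i<n. (dot n (g i) c')\<^sup>2) = a\<^sup>2 * (\<Sum>i<n. (dot n (g i) c)\<^sup>2)"
      unfolding nc(4) power_mult_distrib sum_distrib_left ..
    ultimately have "(p c')\<^sup>2 < (\<Sum>i<n. (dot n (g i) c')\<^sup>2)"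
      using c nc(1) by (simp add: power_mult_distrib)
    also have "\<dots> = (\<Sum>i<n. ((1 - t * N k i) * Y c' i)\<^sup>2)" by (simp add: g s_def)
    finally have "(p c')\<^sup>2 < (\<Sum>i<n. ((1 - t * N k i) * Y c' i)\<^sup>2)" .
    moreover have "c' \<in> S" using nc(2) by (simp add: S_def) (simp add: c'_def)
    ultimately show ?thesis
      by (intro exI[of _ t] exI[of _ c'] conjI t(1,2))
  qed
  define Q where "Q k t c \<longleftrightarrow> 0 < t \<and> t < 1 / (real k + 1) \<and> c \<in> S \<and>
      (p c)\<^sup>2 < (\<Sum>i<n. ((1 - t * N k i) * Y c i)\<^sup>2)" for k t c
  have "\<forall>k. \<exists>t c. Q k t c" unfolding Q_def by (intro allI step)
  then obtain t c where Q: "\<And>k. Q k (t k) (c k)" by metis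
  have t: "0 < t k" "t k < 1 / (real k + 1)" and c: "c k \<in> S"
    and gt: "(p (c k))\<^sup>2 < (\<Sum>i<n. ((1 - t k * N k i) * Y (c k) i)\<^sup>2)" for k
    using Q[of k] by (simp_all add: Q_def)
  have "compact S" unfolding S_def by (rule compact_coordinate_sphere)
  then obtain c0 r where c0: "c0 \<in> S" and r: "strict_mono r" and lim: "(c \<circ> r) \<longlonglongrightarrow> c0"
    using c unfolding compact_def by metis
  have expand: "(\<Sum>i<n. ((1 - t k * N k i) * Y (c k) i)\<^sup>2) =
      (\<Sum>i<n. (Y (c k) i)\<^sup>2) - t k * (2 * (\<Sum>i<n. N k i * (Y (c k) i)\<^sup>2) - t k * (\<Sum>i<n. (N k i * Y (c k) i)\<^sup>2))" for k
    by (simp add: power2_eq_square algebra_simps sum.distrib sum_subtractf sum_distrib_left)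
  \<comment> \<open>Subtracting the contraction bound and dividing by \<open>t k > 0\<close> leaves
    the first-order inequality, with an error of order \<open>t k\<close> that vanishes in the
    limit.\<close>
  have le: "2 * (\<Sum>i<n. N k i * (Y (c k) i)\<^sup>2) \<le> t k * (\<Sum>i<n. (N k i * Y (c k) i)\<^sup>2)" for k
  proof -
    have "(\<Sum>i<n. (Y (c k) i)\<^sup>2) \<le> (p (c k))\<^sup>2" unfolding Y2 p_def by (rule contr)
    with gt[of k] have "t k * (2 * (\<Sum>i<n. N k i * (Y (c k) i)\<^sup>2) - t k * (\<Sum>i<n. (N k i * Y (c k) i)\<^sup>2)) < 0"
      unfolding expand by linarith
    moreover have "0 \<le> t k" using t(1)[of k] by simp
    ultimately show ?thesis
      using mult_nonneg_nonneg[of "t k" "2 * (\<Sum>i<n. N k i * (Y (c k) i)\<^sup>2) - t k * (\<Sum>i<n. (N k i * Y (c k) i)\<^sup>2)"]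
      by linarith
  qed
  have Ylim: "(\<lambda>k. Y (c (r k)) i) \<longlonglongrightarrow> Y c0 i" for i
  proof -
    have "continuous_on UNIV (\<lambda>c. Y c i)"
      unfolding Y_def dot_def by (intro continuous_intros continuous_on_product_coordinates)
    from continuous_on_tendsto_compose[OF this lim] show ?thesis by (simp add: o_def)
  qed
  have plim: "(\<lambda>k. p (c (r k))) \<longlonglongrightarrow> p c0"
    using continuous_on_tendsto_compose[OF continuous_on_norm_combination[of b n] lim]
    by (simp add: o_def p_def)
  have lim1: "(\<lambda>k. 1 / (real (r k) + 1)) \<longlonglongrightarrow> 0"
    using LIMSEQ_subseq_LIMSEQ[OF LIMSEQ_inverse_real_of_nat r]
    by (simp add: o_def inverse_eq_divide add.commute)
  have tlim: "(\<lambda>k. t (r k)) \<longlonglongrightarrow> 0"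
    by (rule tendsto_sandwich[OF _ _ tendsto_const lim1])
      (use t in \<open>auto intro!: always_eventually less_imp_le\<close>)
  have Nlim: "(\<lambda>k. N (r k) i) \<longlonglongrightarrow> \<nu> i - mean" for i
    unfolding N_def using tendsto_diff[OF tendsto_const lim1, of "\<nu> i - mean"] by simp
  have "(\<lambda>k. (p (c (r k)))\<^sup>2) \<longlonglongrightarrow> (p c0)\<^sup>2" by (intro tendsto_power plim)
  moreover have "(\<lambda>k. \<Sum>i<n. ((1 - t (r k) * N (r k) i) * Y (c (r k)) i)\<^sup>2)
      \<longlonglongrightarrow> (\<Sum>i<n. ((1 - 0 * (\<nu> i - mean)) * Y c0 i)\<^sup>2)"
    by (intro tendsto_sum tendsto_power tendsto_mult tendsto_diff tendsto_const Ylim tlim Nlim)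
  \<comment> \<open>The failed contraction bounds survive in the limit as a weak inequality;
    together with \<open>contr\<close> they give equality at \<open>c0\<close>.\<close>
  ultimately have "(p c0)\<^sup>2 \<le> (\<Sum>i<n. ((1 - 0 * (\<nu> i - mean)) * Y c0 i)\<^sup>2)"
    by (rule LIMSEQ_le) (use gt less_imp_le in metis)
  moreover have "(\<Sum>i<n. (Y c0 i)\<^sup>2) \<le> (p c0)\<^sup>2" unfolding Y2 p_def by (rule contr)
  ultimately have eq: "(\<Sum>i<n. (Y c0 i)\<^sup>2) = (p c0)\<^sup>2" by simp
  have "(\<lambda>k. 2 * (\<Sum>i<n. N (r k) i * (Y (c (r k)) i)\<^sup>2)) \<longlonglongrightarrow> 2 * (\<Sum>i<n. (\<nu> i - mean) * (Y c0 i)\<^sup>2)"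
    by (intro tendsto_sum tendsto_power tendsto_mult tendsto_const Ylim Nlim)
  moreover have "(\<lambda>k. t (r k) * (\<Sum>i<n. (N (r k) i * Y (c (r k)) i)\<^sup>2))
      \<longlonglongrightarrow> 0 * (\<Sum>i<n. ((\<nu> i - mean) * Y c0 i)\<^sup>2)"
    by (intro tendsto_sum tendsto_power tendsto_mult tendsto_const Ylim tlim Nlim)
  ultimately have "2 * (\<Sum>i<n. (\<nu> i - mean) * (Y c0 i)\<^sup>2) \<le> 0 * (\<Sum>i<n. ((\<nu> i - mean) * Y c0 i)\<^sup>2)"
    by (rule LIMSEQ_le) (intro exI allI impI le)
  moreover have "(\<Sum>i<n. (\<nu> i - mean) * (Y c0 i)\<^sup>2) = (\<Sum>i<n. \<nu> i * (Y c0 i)\<^sup>2) - mean * (\<Sum>i<n. (Y c0 i)\<^sup>2)"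
    by (simp add: left_diff_distrib sum_subtractf sum_distrib_left)
  ultimately have neg: "(\<Sum>i<n. \<nu> i * (Y c0 i)\<^sup>2) \<le> mean * (p c0)\<^sup>2"
    unfolding eq by simp
  \<comment> \<open>\<open>c0\<close> is normalized in the Euclidean norm of coordinates; a contact
    point needs norm 1 in the given norm.\<close>
  define \<rho> where "\<rho> = p c0"
  have "\<rho> > 0" using indep[of c0] c0 by (auto simp: \<rho>_def p_def S_def)
  define c1 where "c1 = (\<lambda>j. (1 / \<rho>) * c0 j)"
  have Y1: "Y c1 i = (1 / \<rho>) * Y c0 i" for i
    unfolding Y_def c1_def dot_scale_right ..
  have "(\<Sum>j<n. c1 j *\<^sub>R b j) = (1 / \<rho>) *\<^sub>R (\<Sum>j<n. c0 j *\<^sub>R b j)"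
    by (simp add: c1_def scaleR_sum_right)
  then have "p c1 = 1" using \<open>\<rho> > 0\<close> by (simp add: p_def \<rho>_def)
  moreover have "(\<Sum>i<n. (dot n (m i) c1)\<^sup>2) = 1"
  proof -
    have "(\<Sum>i<n. (dot n (m i) c1)\<^sup>2) = (1 / \<rho>)\<^sup>2 * (\<Sum>i<n. (Y c0 i)\<^sup>2)"
      unfolding Y2[symmetric] Y1 power_mult_distrib sum_distrib_left ..
    then show ?thesis using \<open>\<rho> > 0\<close> by (simp add: eq \<rho>_def[symmetric] power_divide)
  qed
  ultimately have "mean < (\<Sum>i<n. \<nu> i * (Y c1 i)\<^sup>2)" by (rule contra)
  also have "\<dots> = (1 / \<rho>)\<^sup>2 * (\<Sum>i<n. \<nu> i * (Y c0 i)\<^sup>2)"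
    unfolding Y1 power_mult_distrib sum_distrib_left by (simp add: mult_ac)
  also have "\<dots> \<le> (1 / \<rho>)\<^sup>2 * (mean * \<rho>\<^sup>2)"
    using neg by (intro mult_left_mono) (auto simp: \<rho>_def)
  also have "\<dots> = mean" using \<open>\<rho> > 0\<close> by (simp add: power_divide)
  finally show False by simp
qed

section \<open>The factorization\<close>

text \<open>The map \<open>W\<^sup>T (W W\<^sup>T)\<^sup>+\<close> in an eigenbasis of \<open>W W\<^sup>T\<close>; for a zero eigenvalue the summand
  vanishes because of \<open>x / 0 = 0\<close>.\<close>

lemma bounded_left_inverse:
  fixes k :: nat
  assumes gram: "\<And>a. \<epsilon>\<^sup>2 * (\<Sum>j<k. (a j)\<^sup>2)
      \<le> dot n (\<lambda>l. \<Sum>j<k. a j * w j l) (\<lambda>l. \<Sum>j<k. a j * w j l)"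
    and \<epsilon>: "\<epsilon> > 0"
  obtains L where
    "\<And>u v. L (\<lambda>l. u l + v l) = (\<lambda>j. L u j + L v j)" "\<And>c u. L (\<lambda>l. c * u l) = (\<lambda>j. c * L u j)"
    "\<And>u j. j \<ge> k \<Longrightarrow> L u j = 0" "\<And>a j. j < k \<Longrightarrow> L (\<lambda>l. \<Sum>j<k. a j * w j l) j = a j"
    "\<And>u. \<epsilon>\<^sup>2 * (\<Sum>j<k. (L u j)\<^sup>2) \<le> dot n u u"
proof -
  obtain e d where e: "onb n e" and A: "\<And>u v. (\<Sum>j<k. dot n (w j) u * dot n (w j) v) =
      (\<Sum>i<n. d i * dot n (e i) u * dot n (e i) v)"
    by (rule gram_diagonal[of n w k]) blast
  define W where "W a = (\<lambda>l. \<Sum>j<k. a j * w j l)" for a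
  define L where "L u j = (if j < k then \<Sum>i<n. dot n (w j) (e i) * dot n (e i) u / d i else 0)" for u j
  have Ae: "(\<Sum>j<k. dot n (w j) (e i) * dot n (w j) v) = d i * dot n (e i) v" if "i < n" for i v
  proof -
    have "(\<Sum>j<k. dot n (w j) (e i) * dot n (w j) v) = (\<Sum>m<n. if m = i then d i * dot n (e i) v else 0)"
      unfolding A using that by (intro sum.cong) (auto simp: onb_dot[OF e])
    then show ?thesis using that by simp
  qed
  have eW: "dot n (e i) (W a) = (\<Sum>j<k. a j * dot n (w j) (e i))" for i a
    unfolding W_def dot_sum_right by (simp add: dot_commute[of n "e i" "w j" for j])
  \<comment> \<open>The composite of \<open>L\<close> and \<open>W\<close> is the orthogonal
    projection onto the span of the eigenvectors with nonzero eigenvalue. Both the norm bound and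
    the left-inverse property follow from this.\<close>
  have eWL: "dot n (e i) (W (L u)) = (if d i = 0 then 0 else dot n (e i) u)" if "i < n" for i u
  proof -
    have "dot n (e i) (W (L u)) = (\<Sum>j<k. \<Sum>m<n. dot n (e m) u / d m * (dot n (w j) (e m) * dot n (w j) (e i)))"
      unfolding eW by (simp add: L_def sum_distrib_left sum_distrib_right mult_ac)
    also have "\<dots> = (\<Sum>m<n. dot n (e m) u / d m * (\<Sum>j<k. dot n (w j) (e m) * dot n (w j) (e i)))"
      by (subst sum.swap) (simp add: sum_distrib_left)
    also have "\<dots> = (\<Sum>m<n. if m = i then dot n (e i) u / d i * d i else 0)"
      using that by (intro sum.cong) (auto simp: Ae onb_dot[OF e])
    finally show ?thesis using that by simp
  qed
  have zero: "dot n (e i) (W a) = 0" if "i < n" "d i = 0" for i a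
  proof -
    have "(\<Sum>j<k. (dot n (w j) (e i))\<^sup>2) = 0"
      using Ae[OF that(1), of "e i"] that(2) by (simp add: power2_eq_square)
    then have "\<forall>j<k. dot n (w j) (e i) = 0" by (simp add: sum_nonneg_eq_0_iff)
    then show ?thesis by (simp add: eW)
  qed
  show ?thesis
  proof (rule that[of L])
    show "L (\<lambda>l. u l + v l) = (\<lambda>j. L u j + L v j)" for u v
      by (rule ext) (simp add: L_def dot_add_right distrib_left add_divide_distrib sum.distrib)
    show "L (\<lambda>l. c * u l) = (\<lambda>j. c * L u j)" for c u
      by (rule ext) (simp add: L_def dot_scale_right sum_distrib_left mult_ac)
    show "L u j = 0" if "j \<ge> k" for u j using that by (simp add: L_def)
    show "\<epsilon>\<^sup>2 * (\<Sum>j<k. (L u j)\<^sup>2) \<le> dot n u u" for u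
    proof -
      have "\<epsilon>\<^sup>2 * (\<Sum>j<k. (L u j)\<^sup>2) \<le> dot n (W (L u)) (W (L u))"
        unfolding W_def by (rule gram)
      also have "\<dots> \<le> dot n u u"
        unfolding parseval_self[OF e] by (rule sum_mono) (simp add: eWL)
      finally show ?thesis .
    qed
    show "L (\<lambda>l. \<Sum>j<k. a j * w j l) j = a j" if "j < k" for a j
    proof -
      \<comment> \<open>The projection fixes \<open>W a\<close>, hence \<open>W f\<close> has length
        0, and the Gram lower bound forces \<open>f\<close> to vanish below
        \<open>k\<close>.\<close>
      define f where "f j = L (W a) j - a j" for j
      have "dot n (e i) (W f) = 0" if "i < n" for i
      proof -
        have "dot n (e i) (W f) = dot n (e i) (W (L (W a))) - dot n (e i) (W a)"
          by (simp add: eW f_def left_diff_distrib sum_subtractf)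
        then show ?thesis using that by (simp add: eWL zero)
      qed
      then have "dot n (W f) (W f) = 0" unfolding parseval_self[OF e] by simp
      then have "\<epsilon>\<^sup>2 * (\<Sum>j<k. (f j)\<^sup>2) \<le> 0" using gram[of f] by (simp add: W_def)
      then have "(\<Sum>j<k. (f j)\<^sup>2) \<le> 0" using \<epsilon> by (simp add: mult_le_0_iff)
      then have "(\<Sum>j<k. (f j)\<^sup>2) = 0" by (intro antisym sum_nonneg) auto
      then have "f j = 0" using that by (simp add: sum_nonneg_eq_0_iff)
      then show ?thesis by (simp add: f_def W_def)
    qed
  qed
qed

text \<open>The finite spanning set makes every basis finite; for an infinite basis
  \<open>card\<close> is 0 and \<open>dim\<close> would carry no information. Independence is
  phrased by \<open>dot n c c = 0\<close> because only coefficients below \<open>n\<close>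
  matter.\<close>

lemma finite_dimensional_coordinates:
  assumes "\<exists>B :: 'a::real_vector set. finite B \<and> span B = UNIV" "dim (UNIV :: 'a set) = n"
  obtains b :: "nat \<Rightarrow> 'a::real_vector" and coord :: "'a::real_vector \<Rightarrow> nat \<Rightarrow> real" where
    "\<And>j. linear (\<lambda>x. coord x j)" "\<And>x. (\<Sum>j<n. coord x j *\<^sub>R b j) = x"
    "\<And>c. (\<Sum>j<n. c j *\<^sub>R b j) = 0 \<Longrightarrow> dot n c c = 0"
    "\<And>c j. j < n \<Longrightarrow> coord (\<Sum>j<n. c j *\<^sub>R b j) j = c j"
proof -
  obtain B0 :: "'a set" where B0: "finite B0" "span B0 = UNIV" using assms(1) by blast
  obtain B :: "'a set" where B': "independent B" "UNIV \<subseteq> span B" "card B = dim (UNIV :: 'a set)"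
    by (rule basis_exists[of "UNIV :: 'a set"]) blast
  then have B: "independent B" "span B = UNIV" "card B = n" using assms(2) by auto
  have fin: "finite B" using independent_span_bound[OF B0(1) B(1)] B0(2) by simp
  obtain b where b: "bij_betw b {..<n} B"
    using ex_bij_betw_nat_finite[OF fin] B(3) by (auto simp: atLeast0LessThan)
  define coord where "coord x j = representation B x (b j)" for x j
  have lin: "linear (\<lambda>x. coord x j)" for j
    unfolding coord_def using B by (intro linearI) (simp_all add: representation_add representation_scale)
  have sum: "(\<Sum>j<n. coord x j *\<^sub>R b j) = x" for x
  proof -
    have "(\<Sum>j<n. coord x j *\<^sub>R b j) = (\<Sum>v\<in>B. representation B x v *\<^sub>R v)"
      unfolding coord_def by (rule sum.reindex_bij_betw[OF b])
    also have "\<dots> = x" using B fin by (intro sum_representation_eq) auto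
    finally show ?thesis .
  qed
  have indep: "c j = 0" if "(\<Sum>j<n. c j *\<^sub>R b j) = 0" "j < n" for c j
  proof -
    have inv: "the_inv_into {..<n} b (b i) = i" if "i < n" for i
      using b that by (intro the_inv_into_f_f) (auto simp: bij_betw_def)
    have "(\<Sum>v\<in>B. c (the_inv_into {..<n} b v) *\<^sub>R v) = (\<Sum>j<n. c (the_inv_into {..<n} b (b j)) *\<^sub>R b j)"
      by (rule sum.reindex_bij_betw[OF b, symmetric])
    also have "\<dots> = 0" using that(1) by (simp add: inv)
    finally have "c (the_inv_into {..<n} b (b j)) = 0"
      by (rule independentD[OF B(1) fin subset_refl]) (use b that(2) in \<open>auto simp: bij_betw_def\<close>)
    then show ?thesis using inv that(2) by simp
  qed
  have indep0: "dot n c c = 0" if "(\<Sum>j<n. c j *\<^sub>R b j) = 0" for c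
    using indep[OF that] by (simp add: dot_def)
  have coord_sum: "coord (\<Sum>j<n. c j *\<^sub>R b j) j = c j" if "j < n" for c j
  proof -
    define x where "x = (\<Sum>j<n. c j *\<^sub>R b j)"
    have "(\<Sum>j<n. (coord x j - c j) *\<^sub>R b j) = 0"
      using sum[of x] by (simp add: scaleR_left_diff_distrib sum_subtractf x_def)
    from indep[OF this that] show ?thesis by (simp add: x_def)
  qed
  show ?thesis by (rule that[OF lin sum indep0 coord_sum])
qed

text \<open>Joins the two halves: the maximal-volume contraction becomes a linear map
  \<open>F\<close> on the space, and its contact points form the set to which
  \<open>restricted_invertibility\<close> is applied.\<close>

lemma euclidean_embedding_with_vectors:
  assumes fin_dim: "\<exists>B :: 'a::real_normed_vector set. finite B \<and> span B = UNIV"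
    and dim_n: "dim (UNIV :: 'a set) = n"
    and eps: "0 < \<epsilon>" "\<epsilon> < 1" and k: "real k \<le> (1 - \<epsilon>)\<^sup>2 * real n"
  obtains F :: "'a::real_normed_vector \<Rightarrow> nat \<Rightarrow> real" and x :: "nat \<Rightarrow> 'a::real_normed_vector" where
    "\<And>l. linear (\<lambda>x. F x l)" "\<And>x. dot n (F x) (F x) \<le> (norm x)\<^sup>2"
    "\<And>j. j < k \<Longrightarrow> norm (x j) = 1"
    "\<And>a. \<epsilon>\<^sup>2 * (\<Sum>j<k. (a j)\<^sup>2) \<le> dot n (\<lambda>l. \<Sum>j<k. a j * F (x j) l) (\<lambda>l. \<Sum>j<k. a j * F (x j) l)"
proof (cases "n = 0")
  case True
  then have "k = 0" using k by simp
  show ?thesis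
    by (rule that[of "\<lambda>_ _. 0"]) (simp_all add: \<open>k = 0\<close> True dot_def module_hom_zero linear_zero)
next
  case False
  obtain b :: "nat \<Rightarrow> 'a" and coord where coord_lin: "\<And>j. linear (\<lambda>x. coord x j)"
    and coord: "\<And>x. (\<Sum>j<n. coord x j *\<^sub>R b j) = x"
    and indep: "\<And>c. (\<Sum>j<n. c j *\<^sub>R b j) = 0 \<Longrightarrow> dot n c c = 0"
    and coord_sum: "\<And>c j. j < n \<Longrightarrow> coord (\<Sum>j<n. c j *\<^sub>R b j) j = c j"
    by (rule finite_dimensional_coordinates[OF fin_dim dim_n]) blast
  obtain m where vol: "vol n m \<noteq> 0"
    and contr: "\<And>c. (\<Sum>i<n. (dot n (m i) c)\<^sup>2) \<le> (norm (\<Sum>j<n. c j *\<^sub>R b j))\<^sup>2"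
    and max: "\<And>g. (\<And>c. (\<Sum>i<n. (dot n (g i) c)\<^sup>2) \<le> (norm (\<Sum>j<n. c j *\<^sub>R b j))\<^sup>2) \<Longrightarrow> \<bar>vol n g\<bar> \<le> \<bar>vol n m\<bar>"
    using maximal_volume[OF indep] by blast
  define F where "F x l = dot n (m l) (coord x)" for x l
  define C where "C = {F x |x. norm x = 1 \<and> dot n (F x) (F x) = 1}"
  have unit: "dot n y y = 1" if "y \<in> C" for y using that by (auto simp: C_def)
  have "\<exists>y\<in>C. (\<Sum>i<n. \<nu> i * (dot n (e i) y)\<^sup>2) \<le> (\<Sum>i<n. \<nu> i) / real n" if e: "onb n e" for e \<nu>
  proof -
    obtain c where c: "norm (\<Sum>j<n. c j *\<^sub>R b j) = 1" "(\<Sum>i<n. (dot n (m i) c)\<^sup>2) = 1"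
      "(\<Sum>i<n. \<nu> i * (dot n (e i) (\<lambda>l. dot n (m l) c))\<^sup>2) \<le> (\<Sum>i<n. \<nu> i) / real n"
      using maximal_volume_contact_points[OF indep _ vol contr max e, of \<nu>] False by blast
    have "F (\<Sum>j<n. c j *\<^sub>R b j) = (\<lambda>l. dot n (m l) c)"
      by (rule ext) (simp add: F_def dot_def coord_sum)
    then show ?thesis using c unfolding C_def
      by (intro bexI[of _ "\<lambda>l. dot n (m l) c"]) (auto simp: dot_self intro!: exI[of _ "\<Sum>j<n. c j *\<^sub>R b j"])
  qed
  from restricted_invertibility[OF unit this eps k] obtain w where w: "\<forall>j<k. w j \<in> C"
    and gram: "\<And>a. \<epsilon>\<^sup>2 * (\<Sum>j<k. (a j)\<^sup>2) \<le> dot n (\<lambda>l. \<Sum>j<k. a j * w j l) (\<lambda>l. \<Sum>j<k. a j * w j l)"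
    by blast
  have "\<forall>j. \<exists>x. j < k \<longrightarrow> w j = F x \<and> norm x = 1" using w by (auto simp: C_def)
  then obtain x where x: "\<And>j. j < k \<Longrightarrow> w j = F (x j)" "\<And>j. j < k \<Longrightarrow> norm (x j) = 1" by metis
  show ?thesis
  proof (rule that[of F x])
    show "linear (\<lambda>x. F x l)" for l
      unfolding F_def dot_def using coord_lin
      by (intro linear_compose_sum) (auto intro: linear_compose_scale_right[where 'b=real, simplified])
    show "dot n (F x) (F x) \<le> (norm x)\<^sup>2" for x
      using contr[of "coord x"] by (simp add: coord dot_self F_def)
    show "norm (x j) = 1" if "j < k" for j using that by (rule x(2))
    show "\<epsilon>\<^sup>2 * (\<Sum>j<k. (a j)\<^sup>2) \<le> dot n (\<lambda>l. \<Sum>j<k. a j * F (x j) l) (\<lambda>l. \<Sum>j<k. a j * F (x j) l)" for a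
      using gram[of a] by (simp add: x(1))
  qed
qed

text \<open>One \<open>k\<close> and one family of unit vectors serve both claims. The operator
  \<beta> has norm at most 1 by the triangle inequality, and \<alpha> is the contraction
  \<open>F\<close> followed by the left inverse \<open>L\<close> of norm at most
  \<open>inverse \<epsilon>\<close>.\<close>

theorem theorem3p1:
  fixes n :: nat and \<epsilon> :: real
  assumes fin_dim: "\<exists>B :: 'a::banach set. finite B \<and> span B = UNIV"
    and dim_n: "dim (UNIV :: 'a set) = n"
    and eps: "0 < \<epsilon>" "\<epsilon> < 1"
  shows "\<exists>k::nat. int k \<ge> \<lfloor>(1 - \<epsilon>)\<^sup>2 * real n\<rfloor> \<and>
    (\<exists>x :: nat \<Rightarrow> 'a. \<forall>a :: nat \<Rightarrow> real.
        \<epsilon> * sqrt (\<Sum>j<k. (a j)\<^sup>2) \<le> norm (\<Sum>j<k. a j *\<^sub>R x j) \<and>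
        norm (\<Sum>j<k. a j *\<^sub>R x j) \<le> (\<Sum>j<k. \<bar>a j\<bar>)) \<and>
    (\<exists>(\<beta> :: (nat \<Rightarrow> real) \<Rightarrow> 'a) (\<alpha> :: 'a \<Rightarrow> (nat \<Rightarrow> real)).
        linear_from_Rvec k \<beta> \<and> linear_to_Rvec k \<alpha> \<and>
        (\<forall>a\<in>Rvec k. (\<alpha> \<circ> \<beta>) a = a) \<and>
        op_norm UNIV norm (lp_norm 2 k) \<alpha> * op_norm (Rvec k) (lp_norm 1 k) norm \<beta> \<le> inverse \<epsilon>)"
proof -
  define k where "k = nat \<lfloor>(1 - \<epsilon>)\<^sup>2 * real n\<rfloor>"
  have k: "real k \<le> (1 - \<epsilon>)\<^sup>2 * real n" by (simp add: k_def)
  have k': "int k \<ge> \<lfloor>(1 - \<epsilon>)\<^sup>2 * real n\<rfloor>" by (simp add: k_def)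
  obtain F :: "'a \<Rightarrow> nat \<Rightarrow> real" and x :: "nat \<Rightarrow> 'a" where
    F: "\<And>l. linear (\<lambda>x. F x l)" and contr: "\<And>x. dot n (F x) (F x) \<le> (norm x)\<^sup>2"
    and x: "\<And>j. j < k \<Longrightarrow> norm (x j) = 1"
    and gram: "\<And>a. \<epsilon>\<^sup>2 * (\<Sum>j<k. (a j)\<^sup>2) \<le> dot n (\<lambda>l. \<Sum>j<k. a j * F (x j) l) (\<lambda>l. \<Sum>j<k. a j * F (x j) l)"
    by (rule euclidean_embedding_with_vectors[OF fin_dim dim_n eps k]) blast
  obtain L where L: "\<And>u v. L (\<lambda>l. u l + v l) = (\<lambda>j. L u j + L v j)" "\<And>c u. L (\<lambda>l. c * u l) = (\<lambda>j. c * L u j)"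
    "\<And>u j. j \<ge> k \<Longrightarrow> L u j = 0" "\<And>a j. j < k \<Longrightarrow> L (\<lambda>l. \<Sum>j<k. a j * F (x j) l) j = a j"
    and L_bound: "\<And>u. \<epsilon>\<^sup>2 * (\<Sum>j<k. (L u j)\<^sup>2) \<le> dot n u u"
    using bounded_left_inverse[of \<epsilon> k n "\<lambda>j. F (x j)", OF gram eps(1)] by blast
  define \<beta> where "\<beta> a = (\<Sum>j<k. a j *\<^sub>R x j)" for a
  define \<alpha> where "\<alpha> y = L (F y)" for y
  have F\<beta>: "F (\<beta> a) = (\<lambda>l. \<Sum>j<k. a j * F (x j) l)" for a
    unfolding \<beta>_def by (rule ext) (simp add: linear_sum[OF F] linear_scale[OF F])
  have upper: "norm (\<beta> a) \<le> (\<Sum>j<k. \<bar>a j\<bar>)" for a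
  proof -
    have "norm (\<beta> a) \<le> (\<Sum>j<k. norm (a j *\<^sub>R x j))" unfolding \<beta>_def by (rule norm_sum)
    then show ?thesis by (simp add: x)
  qed
  have lower: "\<epsilon> * sqrt (\<Sum>j<k. (a j)\<^sup>2) \<le> norm (\<beta> a)" for a
  proof (rule power2_le_imp_le)
    have "(\<epsilon> * sqrt (\<Sum>j<k. (a j)\<^sup>2))\<^sup>2 = \<epsilon>\<^sup>2 * (\<Sum>j<k. (a j)\<^sup>2)"
      by (simp add: power_mult_distrib sum_nonneg)
    also have "\<dots> \<le> (norm (\<beta> a))\<^sup>2"
      using gram[of a] contr[of "\<beta> a"] unfolding F\<beta> by linarith
    finally show "(\<epsilon> * sqrt (\<Sum>j<k. (a j)\<^sup>2))\<^sup>2 \<le> (norm (\<beta> a))\<^sup>2" .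
  qed simp
  have \<beta>_lin: "linear_from_Rvec k \<beta>"
    by (simp add: linear_from_Rvec_def \<beta>_def scaleR_left_distrib sum.distrib scaleR_sum_right)
  have \<alpha>_lin: "linear_to_Rvec k \<alpha>"
  proof -
    have "F (y + z) = (\<lambda>l. F y l + F z l)" "F (c *\<^sub>R y) = (\<lambda>l. c * F y l)" for y z c
      by (simp_all add: fun_eq_iff linear_add[OF F] linear_scale[OF F])
    then show ?thesis by (simp add: linear_to_Rvec_def \<alpha>_def L Rvec_def)
  qed
  have inv: "(\<alpha> \<circ> \<beta>) a = a" if "a \<in> Rvec k" for a
  proof
    fix j
    show "(\<alpha> \<circ> \<beta>) a j = a j"
      using that L(3)[of j] L(4)[of j a] by (cases "j < k") (simp_all add: \<alpha>_def F\<beta> Rvec_def)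
  qed
  have "op_norm UNIV norm (lp_norm 2 k) \<alpha> \<le> inverse \<epsilon>"
    unfolding op_norm_def
  proof (rule cSUP_least)
    show "{v \<in> UNIV. norm v \<le> 1} \<noteq> {}" by (auto intro: exI[of _ 0])
    fix y :: 'a assume "y \<in> {v \<in> UNIV. norm v \<le> 1}"
    then have "(norm y)\<^sup>2 \<le> 1" by (simp add: power_le_one)
    then have "\<epsilon>\<^sup>2 * (\<Sum>j<k. (\<alpha> y j)\<^sup>2) \<le> 1"
      using L_bound[of "F y"] contr[of y] unfolding \<alpha>_def by linarith
    then have "(\<Sum>j<k. (\<alpha> y j)\<^sup>2) \<le> (inverse \<epsilon>)\<^sup>2"
      using eps by (simp add: power_inverse field_simps)
    then have "sqrt (\<Sum>j<k. (\<alpha> y j)\<^sup>2) \<le> inverse \<epsilon>"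
      using eps by (intro real_le_lsqrt) (auto intro: sum_nonneg)
    then show "lp_norm 2 k (\<alpha> y) \<le> inverse \<epsilon>" by (simp add: lp_norm_2)
  qed
  moreover have \<beta>1: "norm (\<beta> a) \<le> 1" if "a \<in> {a \<in> Rvec k. lp_norm 1 k a \<le> 1}" for a
    using that upper[of a] by (simp add: lp_norm_1)
  have zero: "(\<lambda>_. 0) \<in> {a \<in> Rvec k. lp_norm 1 k a \<le> 1}" by (simp add: Rvec_def lp_norm_1)
  have "op_norm (Rvec k) (lp_norm 1 k) norm \<beta> \<le> 1"
    unfolding op_norm_def by (rule cSUP_least) (use zero \<beta>1 in auto)
  \<comment> \<open>Multiplying the two norm bounds needs this sign; a real supremum inherits it
    only from a nonempty set that is bounded above.\<close>
  moreover have "0 \<le> op_norm (Rvec k) (lp_norm 1 k) norm \<beta>"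
  proof -
    have "bdd_above ((\<lambda>a. norm (\<beta> a)) ` {a \<in> Rvec k. lp_norm 1 k a \<le> 1})"
      by (rule bdd_aboveI2[of _ _ 1]) (rule \<beta>1)
    from cSUP_upper[OF zero this] have "norm (\<beta> (\<lambda>_. 0)) \<le> op_norm (Rvec k) (lp_norm 1 k) norm \<beta>"
      unfolding op_norm_def .
    then show ?thesis by (rule order_trans[OF norm_ge_zero])
  qed
  ultimately have "op_norm UNIV norm (lp_norm 2 k) \<alpha> * op_norm (Rvec k) (lp_norm 1 k) norm \<beta> \<le> inverse \<epsilon> * 1"
    using eps by (intro mult_mono) auto
  then have "op_norm UNIV norm (lp_norm 2 k) \<alpha> * op_norm (Rvec k) (lp_norm 1 k) norm \<beta> \<le> inverse \<epsilon>" by simp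
  then show ?thesis
    using k' lower upper \<beta>_lin \<alpha>_lin inv unfolding \<beta>_def by blast
qed

end
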